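(* Let $\mathcal{U}$ be a vector space of real functions on $[a,b]$, let $u=(u_0,\ldots,u_n)$ be a normalized totally positive (NTP) basis of $\mathcal{U}$ on $[a,b]$, and let $v=(b_0,\ldots,b_n)$ be the normalized B-basis of $\mathcal{U}$. Let $\mathbf{t}=(t_i)_{i=0}^n$ be an increasing sequence of nodes $t_0<t_1<\cdots<t_n$ in $[a,b]$, and let $A=(u_j(t_i))_{0\le i,j\le n}$ and $M=(b_j(t_i))_{0\le i,j\le n}$ be the collocation matrices at $\mathbf{t}$ of $u$ and $v$, respectively. Then the minimal eigenvalue of $M$ is greater than or equal to the minimal eigenvalue of $A$, and the minimal singular value of $M$ is greater than or equal to the minimal singular value of $A$. Moreover, if $A$ and $M$ are nonsingular, then $$\kappa_1(M^T)=\kappa_\infty(M)\le \kappa_\infty(A)=\kappa_1(A^T).$$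
   Context: A real matrix is totally positive (TP) if all its minors are nonnegative. All eigenvalues of a square TP matrix are real and nonnegative, so "minimal eigenvalue" means the smallest one. A square matrix is stochastic if it is (entrywise) nonnegative and each of its rows sums to $1$. For a system of real functions $(u_0,\ldots,u_n)$ on an interval $I$ and points $t_0<\cdots<t_m$ in $I$, the collocation matrix of the system at these points is $(u_j(t_i))_{i=0,\ldots,m;\,j=0,\ldots,n}$. The system is TP if all its collocation matrices (for all $m$ and all $t_0<\cdots<t_m$ in $I$) are TP. It is normalized if $\sum_{i=0}^n u_i(t)=1$ for all $t\in I$. An NTP system is one that is both normalized and TP. Given a space $\mathcal{U}$ possessing an NTP basis, its normalized B-basis is the unique NTP basis $(b_0,\ldots,b_n)$ of $\mathcal{U}$ with optimal shape preserving properties, i.e. such that for every NTP basis $(u_0,\ldots,u_n)$ of $\mathcal{U}$ there is a nonsingular stochastic TP matrix $K$ with $(u_0,\ldots,u_n)=(b_0,\ldots,b_n)K$. (It is known that such a basis exists and is unique.) For a nonsingular matrix $B$ and $p\in\{1,\infty\}$, $\kappa_p(B):=\|B\|_p\,\|B^{-1}\|_p$, where $\|\cdot\|_p$ is the matrix norm induced by the vector $p$-norm. *)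

theory Defs
  imports
    Complex_Main
    "HOL-Library.FuncSet"
    "Jordan_Normal_Form.Char_Poly"
    "Jordan_Normal_Form.DL_Submatrix"
    "Jordan_Normal_Form.Gauss_Jordan_Elimination"
begin

definition totally_positive_mat :: "real mat \<Rightarrow> bool" where
  "totally_positive_mat A \<longleftrightarrow>
     (\<forall>R C. R \<subseteq> {..<dim_row A} \<and> C \<subseteq> {..<dim_col A} \<and> card R = card C \<longrightarrow>
        det (submatrix A R C) \<ge> 0)"

definition stochastic_mat :: "real mat \<Rightarrow> bool" where
  "stochastic_mat A \<longleftrightarrow> square_mat A \<and>
     (\<forall>i<dim_row A. \<forall>j<dim_col A. A $$ (i, j) \<ge> 0) \<and>
     (\<forall>i<dim_row A. (\<Sum>j<dim_col A. A $$ (i, j)) = 1)"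

text \<open>A system of functions \<open>u 0, ..., u n\<close> is given by \<open>n\<close> and \<open>u\<close>; the values of \<open>u\<close> at
  indices above \<open>n\<close> are irrelevant. Likewise only the nodes \<open>t 0, ..., t m\<close> matter.\<close>

definition collocation_mat ::
  "nat \<Rightarrow> nat \<Rightarrow> (nat \<Rightarrow> real \<Rightarrow> real) \<Rightarrow> (nat \<Rightarrow> real) \<Rightarrow> real mat" where
  "collocation_mat m n u t = mat (m + 1) (n + 1) (\<lambda>(i, j). u j (t i))"

definition nodes_in :: "real set \<Rightarrow> nat \<Rightarrow> (nat \<Rightarrow> real) \<Rightarrow> bool" where
  "nodes_in I m t \<longleftrightarrow> (\<forall>i\<le>m. t i \<in> I) \<and> strict_mono_on {..m} t"

definition TP_system :: "real set \<Rightarrow> nat \<Rightarrow> (nat \<Rightarrow> real \<Rightarrow> real) \<Rightarrow> bool" where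
  "TP_system I n u \<longleftrightarrow>
     (\<forall>m t. nodes_in I m t \<longrightarrow> totally_positive_mat (collocation_mat m n u t))"

definition normalized_system :: "real set \<Rightarrow> nat \<Rightarrow> (nat \<Rightarrow> real \<Rightarrow> real) \<Rightarrow> bool" where
  "normalized_system I n u \<longleftrightarrow> (\<forall>x\<in>I. (\<Sum>j\<le>n. u j x) = 1)"

text \<open>A real function on \<open>I\<close> is represented by a function that is \<open>undefined\<close> outside \<open>I\<close>,
  so that equality of such functions is equality on \<open>I\<close>.\<close>

definition function_space :: "real set \<Rightarrow> (real \<Rightarrow> real) set \<Rightarrow> bool" where
  "function_space I U \<longleftrightarrow>
     U \<subseteq> extensional I \<and>
     (\<lambda>x\<in>I. 0) \<in> U \<and>
     (\<forall>f\<in>U. \<forall>g\<in>U. (\<lambda>x\<in>I. f x + g x) \<in> U) \<and>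
     (\<forall>c. \<forall>f\<in>U. (\<lambda>x\<in>I. c * f x) \<in> U)"

definition basis_of ::
  "real set \<Rightarrow> (real \<Rightarrow> real) set \<Rightarrow> nat \<Rightarrow> (nat \<Rightarrow> real \<Rightarrow> real) \<Rightarrow> bool" where
  "basis_of I U n u \<longleftrightarrow>
     (\<forall>j\<le>n. u j \<in> U) \<and>
     (\<forall>c. (\<forall>x\<in>I. (\<Sum>j\<le>n. c j * u j x) = 0) \<longrightarrow> (\<forall>j\<le>n. c j = 0)) \<and>
     (\<forall>f\<in>U. \<exists>c. \<forall>x\<in>I. f x = (\<Sum>j\<le>n. c j * u j x))"

definition NTP_basis ::
  "real set \<Rightarrow> (real \<Rightarrow> real) set \<Rightarrow> nat \<Rightarrow> (nat \<Rightarrow> real \<Rightarrow> real) \<Rightarrow> bool" where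
  "NTP_basis I U n u \<longleftrightarrow> basis_of I U n u \<and> normalized_system I n u \<and> TP_system I n u"

text \<open>All bases of \<open>U\<close> have the same length, so it is enough to compare with NTP bases
  \<open>u 0, ..., u n\<close> for the same \<open>n\<close>. The last conjunct is \<open>(u\<^sub>0, ..., u\<^sub>n) = (b\<^sub>0, ..., b\<^sub>n) K\<close>.\<close>

definition normalized_B_basis ::
  "real set \<Rightarrow> (real \<Rightarrow> real) set \<Rightarrow> nat \<Rightarrow> (nat \<Rightarrow> real \<Rightarrow> real) \<Rightarrow> bool" where
  "normalized_B_basis I U n b \<longleftrightarrow>
     NTP_basis I U n b \<and>
     (\<forall>u. NTP_basis I U n u \<longrightarrow>
        (\<exists>K \<in> carrier_mat (n + 1) (n + 1).
           invertible_mat K \<and> stochastic_mat K \<and> totally_positive_mat K \<and>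
           (\<forall>j\<le>n. \<forall>x\<in>I. u j x = (\<Sum>i\<le>n. b i x * K $$ (i, j)))))"

text \<open>Meant for matrices all of whose eigenvalues are real, such as totally positive matrices;
  for these the real spectrum used here is the whole spectrum.\<close>

definition min_eigenvalue :: "real mat \<Rightarrow> real" where
  "min_eigenvalue A = Min {k. eigenvalue A k}"

text \<open>For square \<open>A\<close>, the singular values are the square roots of all eigenvalues of \<open>A\<^sup>T A\<close>.\<close>

definition singular_values :: "real mat \<Rightarrow> real set" where
  "singular_values A = sqrt ` {k. eigenvalue (transpose_mat A * A) k}"

definition min_singular_value :: "real mat \<Rightarrow> real" where
  "min_singular_value A = Min (singular_values A)"

definition vec_norm_1 :: "real vec \<Rightarrow> real" where
  "vec_norm_1 x = (\<Sum>i<dim_vec x. \<bar>x $ i\<bar>)"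

definition vec_norm_inf :: "real vec \<Rightarrow> real" where
  "vec_norm_inf x = Max ((\<lambda>i. \<bar>x $ i\<bar>) ` {..<dim_vec x})"

definition induced_norm :: "(real vec \<Rightarrow> real) \<Rightarrow> real mat \<Rightarrow> real" where
  "induced_norm N A =
     (SUP x \<in> carrier_vec (dim_col A) - {0\<^sub>v (dim_col A)}. N (A *\<^sub>v x) / N x)"

text \<open>Only meaningful for nonsingular \<open>B\<close>; \<open>mat_inverse B\<close> is \<open>None\<close> otherwise.\<close>

definition cond_number :: "(real vec \<Rightarrow> real) \<Rightarrow> real mat \<Rightarrow> real" where
  "cond_number N B = induced_norm N B * induced_norm N (the (mat_inverse B))"

abbreviation kappa_1 :: "real mat \<Rightarrow> real" where
  "kappa_1 \<equiv> cond_number vec_norm_1"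

abbreviation kappa_inf :: "real mat \<Rightarrow> real" where
  "kappa_inf \<equiv> cond_number vec_norm_inf"

end

theory Submission
  imports Defs "Jordan_Normal_Form.Spectral_Radius"
begin

text \<open>Write \<open>A = M K\<close> with \<open>K\<close> nonsingular, stochastic and totally positive, and let
  \<open>J = diag (1, -1, 1, ...)\<close>. For a nonsingular totally positive matrix \<open>X\<close> the matrix \<open>J X\<inverse> J\<close>
  is nonnegative, and \<open>det K \<le> k\<^sub>i\<^sub>i det K(i|i)\<close> together with \<open>k\<^sub>i\<^sub>i \<le> 1\<close> shows that the
  diagonal of \<open>J K\<inverse> J\<close> is at least \<open>1\<close>. Hence
  \<open>J A\<inverse> J = (J K\<inverse> J) (J M\<inverse> J) \<ge> J M\<inverse> J \<ge> 0\<close> entrywise, and the same holds for the inverses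
  of \<open>A\<^sup>T A\<close> and \<open>M\<^sup>T M\<close>. By Perron--Frobenius monotonicity the largest
  eigenvalues of the inverses, i.e. the reciprocals of the least eigenvalues, are ordered accordingly.
  For the condition numbers, \<open>\<parallel>A\<parallel> = \<parallel>M\<parallel> = 1\<close> in the maximum norm and
  \<open>M\<inverse> = K A\<inverse>\<close> with \<open>\<parallel>K\<parallel> = 1\<close>.\<close>

subsection \<open>Minors and Schur complements of totally positive matrices\<close>

abbreviation fmat :: "nat \<Rightarrow> (nat \<Rightarrow> nat \<Rightarrow> 'a) \<Rightarrow> 'a mat" where
  "fmat n a \<equiv> mat n n (\<lambda>(i, j). a i j)"

text \<open>Selections of \<open>k\<close> indices below \<open>n\<close> are encoded as maps, not
  as sets as in \<open>totally_positive_mat\<close>. A minor of a minor then comes from composing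
  maps, and prepending or reversing indices are operations on maps.\<close>

definition incr_index :: "nat \<Rightarrow> nat \<Rightarrow> (nat \<Rightarrow> nat) \<Rightarrow> bool" where
  "incr_index k n f \<longleftrightarrow> strict_mono_on {..<k} f \<and> f ` {..<k} \<subseteq> {..<n}"

definition TP_fun :: "nat \<Rightarrow> (nat \<Rightarrow> nat \<Rightarrow> real) \<Rightarrow> bool" where
  "TP_fun n a \<longleftrightarrow>
     (\<forall>k f g. incr_index k n f \<longrightarrow> incr_index k n g \<longrightarrow> det (fmat k (\<lambda>i j. a (f i) (g j))) \<ge> 0)"

text \<open>The element \<open>f i\<close> of the image has exactly \<open>i\<close> smaller
  elements there, and \<open>pick\<close> is determined by that count. This translates
  \<open>submatrix\<close> into index maps.\<close>

lemma pick_strict_mono_image: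
  assumes f: "strict_mono_on {..<k} f" and i: "i < k"
  shows "pick (f ` {..<k}) i = f i"
proof -
  have "{a \<in> f ` {..<k}. a < f i} = f ` {..<i}"
    using f i by (auto simp: strict_mono_on_less)
  moreover have "inj_on f {..<i}"
    by (rule inj_on_subset[OF strict_mono_on_imp_inj_on[OF f]]) (use i in auto)
  ultimately have "card {a \<in> f ` {..<k}. a < f i} = i"
    by (simp add: card_image)
  with pick_card_in_set[of "f i" "f ` {..<k}"] i show ?thesis by auto
qed

lemma totally_positive_mat_imp_TP_fun:
  assumes A: "A \<in> carrier_mat n n" and tp: "totally_positive_mat A"
  shows "TP_fun n (\<lambda>i j. A $$ (i, j))"
  unfolding TP_fun_def
proof (intro allI impI)
  fix k f g
  assume "incr_index k n f" "incr_index k n g"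
  then have f: "strict_mono_on {..<k} f" "f ` {..<k} \<subseteq> {..<n}"
    and g: "strict_mono_on {..<k} g" "g ` {..<k} \<subseteq> {..<n}"
    by (auto simp: incr_index_def)
  have card: "card (h ` {..<k}) = k" if "strict_mono_on {..<k} h" for h :: "nat \<Rightarrow> nat"
    using strict_mono_on_imp_inj_on[OF that] by (simp add: card_image)
  have set: "{i. i < n \<and> i \<in> h ` {..<k}} = h ` {..<k}" if "h ` {..<k} \<subseteq> {..<n}" for h :: "nat \<Rightarrow> nat"
    using that by auto
  have "submatrix A (f ` {..<k}) (g ` {..<k}) = fmat k (\<lambda>i j. A $$ (f i, g j))"
    unfolding submatrix_def using A f g
    by (auto simp: set card pick_strict_mono_image)
  moreover have "det (submatrix A (f ` {..<k}) (g ` {..<k})) \<ge> 0"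
    using tp A f g by (auto simp: totally_positive_mat_def card)
  ultimately show "det (fmat k (\<lambda>i j. A $$ (f i, g j))) \<ge> 0" by simp
qed

text \<open>One step of Gaussian elimination: the unit lower triangular \<open>E\<close> clears
  column 0 below the pivot without changing the determinant, and Laplace expansion along that column
  leaves the Schur complement.\<close>

lemma det_fmat_pivot:
  fixes a :: "nat \<Rightarrow> nat \<Rightarrow> 'a::field"
  assumes a: "a 0 0 \<noteq> 0"
  shows "det (fmat (Suc k) a) =
    a 0 0 * det (fmat k (\<lambda>i j. a (Suc i) (Suc j) - a (Suc i) 0 * a 0 (Suc j) / a 0 0))"
proof -
  define E where "E = fmat (Suc k) (\<lambda>i j. if i = j then 1 else if j = 0 then - a i 0 / a 0 0 else 0)"
  define B where "B = fmat (Suc k) (\<lambda>i j. if i = 0 then a 0 j else a i j - a i 0 * a 0 j / a 0 0)"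
  have E: "E \<in> carrier_mat (Suc k) (Suc k)" and B: "B \<in> carrier_mat (Suc k) (Suc k)"
    by (auto simp: E_def B_def)
  have "det E = prod_list (diag_mat E)"
    by (rule det_lower_triangular[OF _ E]) (auto simp: E_def)
  also have "diag_mat E = map (\<lambda>i. 1) [0..<Suc k]"
    by (auto simp: diag_mat_def E_def simp del: upt_Suc)
  finally have dE: "det E = 1"
    by (simp add: map_replicate_const del: upt_Suc)
  have "E * fmat (Suc k) a = B"
  proof (rule eq_matI)
    fix i j assume "i < dim_row B" "j < dim_col B"
    then have ij: "i < Suc k" "j < Suc k" by (auto simp: B_def)
    have "(E * fmat (Suc k) a) $$ (i, j) = (\<Sum>l<Suc k. E $$ (i, l) * a l j)"
      using ij E by (simp add: scalar_prod_def atLeast0LessThan)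
    \<comment> \<open>Row \<open>i\<close> of \<open>E\<close> has entries only in columns
      \<open>i\<close> and 0; the guard \<open>i \<noteq> 0\<close> keeps the diagonal entry of row
      0 from being counted twice.\<close>
    also have "\<dots> = (\<Sum>l<Suc k. (if l = i then a i j else 0) +
        (if l = 0 \<and> i \<noteq> 0 then - a i 0 / a 0 0 * a 0 j else 0))"
      using ij by (intro sum.cong) (auto simp: E_def)
    also have "\<dots> = B $$ (i, j)"
      unfolding sum.distrib using ij by (cases "i = 0") (auto simp: B_def sum.delta)
    finally show "(E * fmat (Suc k) a) $$ (i, j) = B $$ (i, j)" .
  qed (auto simp: E_def B_def)
  then have "det (fmat (Suc k) a) = det B"
    using det_mult[OF E, of "fmat (Suc k) a"] dE by auto
  also have "det B = (\<Sum>i<Suc k. B $$ (i, 0) * cofactor B i 0)"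
    by (rule laplace_expansion_column[OF B]) simp
  also have "\<dots> = (\<Sum>i<Suc k. if i = 0 then a 0 0 * cofactor B 0 0 else 0)"
    using a by (intro sum.cong) (auto simp: B_def)
  also have "\<dots> = a 0 0 * det (mat_delete B 0 0)"
    by (simp add: cofactor_def)
  also have "mat_delete B 0 0 = fmat k (\<lambda>i j. a (Suc i) (Suc j) - a (Suc i) 0 * a 0 (Suc j) / a 0 0)"
    by (auto simp: mat_delete_def B_def)
  finally show ?thesis .
qed

lemma TP_fun_nonneg:
  assumes "TP_fun n a" "i < n" "j < n"
  shows "a i j \<ge> 0"
proof -
  have "incr_index 1 n (\<lambda>_. i)" "incr_index 1 n (\<lambda>_. j)"
    using assms(2,3) by (auto simp: incr_index_def strict_mono_on_def)
  with assms(1) have "det (fmat 1 (\<lambda>_ _. a i j)) \<ge> 0" by (auto simp: TP_fun_def)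
  then show ?thesis by (subst (asm) det_single) auto
qed

lemma incr_index_id: "incr_index n n (\<lambda>i. i)"
  by (auto simp: incr_index_def strict_mono_on_def)

lemma TP_fun_det: "TP_fun n a \<Longrightarrow> det (fmat n a) \<ge> 0"
  using incr_index_id[of n] unfolding TP_fun_def by blast

lemma incr_index_comp:
  "incr_index k m f \<Longrightarrow> incr_index m n g \<Longrightarrow> incr_index k n (\<lambda>i. g (f i))"
  by (fastforce simp: incr_index_def strict_mono_on_def image_subset_iff)

lemma TP_fun_minor:
  "TP_fun n a \<Longrightarrow> incr_index m n f \<Longrightarrow> incr_index m n g \<Longrightarrow> TP_fun m (\<lambda>i j. a (f i) (g j))"
  unfolding TP_fun_def by (blast intro: incr_index_comp)

lemma incr_index_insert_index: "incr_index n (Suc n) (insert_index i)"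
  by (auto simp: incr_index_def strict_mono_on_def insert_index_def)

text \<open>Prepending index 0 to the selected rows and columns (the map \<open>?e\<close>) gives a
  minor of \<open>a\<close> that equals the pivot times the given minor of the Schur complement, by
  \<open>det_fmat_pivot\<close>.\<close>

lemma TP_fun_schur:
  assumes tp: "TP_fun (Suc n) a" and a: "a 0 0 > 0"
  shows "TP_fun n (\<lambda>i j. a (Suc i) (Suc j) - a (Suc i) 0 * a 0 (Suc j) / a 0 0)"
  unfolding TP_fun_def
proof (intro allI impI)
  fix k f g
  assume f: "incr_index k n f" and g: "incr_index k n g"
  let ?e = "\<lambda>h i. case i of 0 \<Rightarrow> 0 | Suc i \<Rightarrow> Suc (h i)"
  have e: "incr_index (Suc k) (Suc n) (?e h)" if "incr_index k n h" for h
    using that by (fastforce simp: incr_index_def strict_mono_on_def split: nat.splits)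
  have "0 \<le> det (fmat (Suc k) (\<lambda>i j. a (?e f i) (?e g j)))"
    using tp e[OF f] e[OF g] by (auto simp: TP_fun_def)
  also have "\<dots> = a 0 0 * det (fmat k (\<lambda>i j. a (Suc (f i)) (Suc (g j))
      - a (Suc (f i)) 0 * a 0 (Suc (g j)) / a 0 0))"
    using a by (subst det_fmat_pivot) auto
  finally show "det (fmat k (\<lambda>i j. a (Suc (f i)) (Suc (g j))
      - a (Suc (f i)) 0 * a 0 (Suc (g j)) / a 0 0)) \<ge> 0"
    using a by (simp add: zero_le_mult_iff)
qed

text \<open>Rows and columns undergo the same permutation, so its sign enters twice and cancels.
  Columns are handled as rows of the transpose.\<close>

lemma det_fmat_reverse:
  fixes a :: "nat \<Rightarrow> nat \<Rightarrow> 'a::comm_ring_1"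
  shows "det (fmat k (\<lambda>i j. a (k - 1 - i) (k - 1 - j))) = det (fmat k a)"
proof -
  define p where "p = (\<lambda>i. if i < k then k - 1 - i else i)"
  have p: "p permutes {0..<k}"
    by (rule bij_imp_permutes[OF bij_betw_byWitness[where f' = p]]) (auto simp: p_def)
  have row: "det (fmat k (\<lambda>i j. b (p i) j)) = signof p * det (fmat k b)" for b :: "nat \<Rightarrow> nat \<Rightarrow> 'a"
  proof -
    have "fmat k (\<lambda>i j. b (p i) j) = mat k k (\<lambda>(i, j). fmat k b $$ (p i, j))"
      by (auto simp: p_def)
    then show ?thesis using det_permute_rows[OF _ p, of "fmat k b"] by simp
  qed
  have tr: "det (fmat k (\<lambda>i j. b j i)) = det (fmat k b)" for b :: "nat \<Rightarrow> nat \<Rightarrow> 'a"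
  proof -
    have "fmat k (\<lambda>i j. b j i) = transpose_mat (fmat k b)" by auto
    then show ?thesis using det_transpose[of "fmat k b" k] by simp
  qed
  have "det (fmat k (\<lambda>i j. a (k - 1 - i) (k - 1 - j))) = det (fmat k (\<lambda>i j. a (p i) (p j)))"
    by (rule arg_cong[of _ _ det]) (auto simp: p_def)
  also have "\<dots> = signof p * det (fmat k (\<lambda>i j. a i (p j)))"
    by (rule row)
  also have "det (fmat k (\<lambda>i j. a i (p j))) = det (fmat k (\<lambda>i j. a j (p i)))"
    by (rule tr)
  also have "\<dots> = signof p * det (fmat k (\<lambda>i j. a j i))"
    by (rule row[of "\<lambda>i j. a j i"])
  also have "det (fmat k (\<lambda>i j. a j i)) = det (fmat k a)"
    by (rule tr)
  finally show ?thesis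
    by (simp add: sign_def)
qed

lemma TP_fun_reverse:
  assumes tp: "TP_fun n a"
  shows "TP_fun n (\<lambda>i j. a (n - 1 - i) (n - 1 - j))"
  unfolding TP_fun_def
proof (intro allI impI)
  fix k f g
  assume f: "incr_index k n f" and g: "incr_index k n g"
  \<comment> \<open>Reflecting the values reverses their order; reflecting the argument as well
    makes the selection increasing again.\<close>
  let ?r = "\<lambda>h i. n - 1 - h (k - 1 - i)"
  have r: "incr_index k n (?r h)" if "incr_index k n h" for h
    unfolding incr_index_def strict_mono_on_def
  proof (intro conjI allI impI image_subsetI)
    fix i j assume ij: "i \<in> {..<k} \<and> j \<in> {..<k} \<and> i < j"
    then have "h (k - 1 - j) < h (k - 1 - i)" "h (k - 1 - i) < n"
      using that by (auto simp: incr_index_def strict_mono_on_def image_subset_iff)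
    then show "?r h i < ?r h j" by linarith
  next
    fix i assume i: "i \<in> {..<k}"
    then have "h (k - 1 - i) < n"
      using that by (auto simp: incr_index_def image_subset_iff)
    then show "?r h i \<in> {..<n}" by auto
  qed
  have "0 \<le> det (fmat k (\<lambda>i j. a (?r f i) (?r g j)))"
    using tp r[OF f] r[OF g] by (auto simp: TP_fun_def)
  also have "\<dots> = det (fmat k (\<lambda>i j. a (n - 1 - f i) (n - 1 - g j)))"
    by (rule det_fmat_reverse)
  finally show "det (fmat k (\<lambda>i j. a (n - 1 - f i) (n - 1 - g j))) \<ge> 0" .
qed

lemma det_fmat_zero_row:
  fixes a :: "nat \<Rightarrow> nat \<Rightarrow> 'a::comm_ring_1"
  assumes "i < n" "\<And>j. j < n \<Longrightarrow> a i j = 0"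
  shows "det (fmat n a) = 0"
  using assms by (subst laplace_expansion_row[of _ n i]) auto

lemma det_fmat_zero_col:
  fixes a :: "nat \<Rightarrow> nat \<Rightarrow> 'a::comm_ring_1"
  assumes "j < n" "\<And>i. i < n \<Longrightarrow> a i j = 0"
  shows "det (fmat n a) = 0"
  using assms by (subst laplace_expansion_column[of _ n j]) auto

lemma det_fmat_2:
  fixes a :: "nat \<Rightarrow> nat \<Rightarrow> 'a::comm_ring_1"
  shows "det (fmat 2 a) = a 0 0 * a 1 1 - a 0 1 * a 1 0"
proof -
  have "det (mat_delete (fmat 2 a) 0 j) = a 1 (1 - j)" if "j < 2" for j
    using that by (subst det_single) (auto simp: mat_delete_def less_2_cases_iff)
  then show ?thesis
    by (subst laplace_expansion_row[of _ 2 0]) (auto simp: cofactor_def lessThan_nat_numeral)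
qed

text \<open>If the corner entry were 0, nonsingularity would give some \<open>a i 0 > 0\<close>. The
  minor in rows \<open>0, i\<close> and columns \<open>0, j\<close> is then
  \<open>- a 0 j * a i 0\<close>, which forces all of row 0 to vanish, against
  nonsingularity.\<close>

lemma TP_fun_pivot_pos:
  assumes tp: "TP_fun (Suc n) a" and d: "det (fmat (Suc n) a) \<noteq> 0"
  shows "a 0 0 > 0"
proof (rule ccontr)
  assume "\<not> a 0 0 > 0"
  with TP_fun_nonneg[OF tp, of 0 0] have a: "a 0 0 = 0" by simp
  from d obtain i where i: "i < Suc n" "a i 0 \<noteq> 0"
    using det_fmat_zero_col[of 0 "Suc n" a] by auto
  have i': "a i 0 > 0" using TP_fun_nonneg[OF tp, of i 0] i by simp
  have "0 < i" using i a by (cases i) auto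
  have "a 0 j = 0" if j: "j < Suc n" for j
  proof (cases "j = 0")
    case False
    let ?f = "\<lambda>i l::nat. if l = 0 then 0 else i"
    have f: "incr_index 2 (Suc n) (?f l)" if "0 < l" "l < Suc n" for l
      using that by (auto simp: incr_index_def strict_mono_on_def)
    have "0 \<le> det (fmat 2 (\<lambda>p q. a (?f i p) (?f j q)))"
      using tp f[of i] f[of j] i \<open>0 < i\<close> j False by (auto simp: TP_fun_def)
    then have "a 0 j * a i 0 \<le> 0"
      by (simp add: det_fmat_2 a)
    with i' TP_fun_nonneg[OF tp, of 0 j] j show ?thesis
      by (auto simp: mult_le_0_iff)
  qed (use a in auto)
  with det_fmat_zero_row[of 0 "Suc n" a] d show False by auto
qed

text \<open>Schur complementation at the first pivot only shrinks the diagonal entries, which gives the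
  induction step for \<open>i > 0\<close>; reversing the order of rows and columns reduces \<open>i = 0\<close> to the last index.\<close>

lemma TP_fun_det_le_diag:
  assumes "TP_fun (Suc n) a" "det (fmat (Suc n) a) \<noteq> 0" "i < Suc n"
  shows "det (fmat (Suc n) a) \<le> a i i * det (fmat n (\<lambda>p q. a (insert_index i p) (insert_index i q)))"
  using assms
proof (induction n arbitrary: a i)
  case 0
  then show ?case by (simp add: det_single)
next
  case (Suc n)
  \<comment> \<open>The case of a positive index is stated for arbitrary \<open>a\<close> and
    \<open>i\<close>, because it is applied a second time to the reversed matrix.\<close>
  have pos: "det (fmat (Suc (Suc n)) a) \<le>
      a (Suc i) (Suc i) * det (fmat (Suc n) (\<lambda>p q. a (insert_index (Suc i) p) (insert_index (Suc i) q)))"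
    if tp: "TP_fun (Suc (Suc n)) a" and d: "det (fmat (Suc (Suc n)) a) \<noteq> 0" and i: "i < Suc n" for a i
  proof -
    have a: "a 0 0 > 0" by (rule TP_fun_pivot_pos[OF tp d])
    define s where "s = (\<lambda>i j. a (Suc i) (Suc j) - a (Suc i) 0 * a 0 (Suc j) / a 0 0)"
    have s: "TP_fun (Suc n) s" unfolding s_def by (rule TP_fun_schur[OF tp a])
    let ?s = "det (fmat n (\<lambda>p q. s (insert_index i p) (insert_index i q)))"
    have das: "det (fmat (Suc (Suc n)) a) = a 0 0 * det (fmat (Suc n) s)"
      unfolding s_def using a by (intro det_fmat_pivot) auto
    also have "\<dots> \<le> a 0 0 * (s i i * ?s)"
      using Suc.IH[OF s _ i] a d das by auto
    also have "\<dots> \<le> a 0 0 * (a (Suc i) (Suc i) * ?s)"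
    proof -
      have "?s \<ge> 0" by (intro TP_fun_det TP_fun_minor[OF s] incr_index_insert_index)
      moreover have "s i i \<le> a (Suc i) (Suc i)"
        using TP_fun_nonneg[OF tp, of 0 "Suc i"] TP_fun_nonneg[OF tp, of "Suc i" 0] a i
        by (auto simp: s_def)
      ultimately show ?thesis using a by (intro mult_left_mono mult_right_mono) auto
    qed
    \<comment> \<open>Elimination with pivot \<open>a 0 0\<close> commutes with deleting row and
      column \<open>Suc i\<close>, so the left-hand side is the pivot expansion of the minor on the
      right.\<close>
    also have "a 0 0 * ?s = det (fmat (Suc n) (\<lambda>p q. a (insert_index (Suc i) p) (insert_index (Suc i) q)))"
    proof -
      have "insert_index (Suc i) (Suc p) = Suc (insert_index i p)" for p
        by (auto simp: insert_index_def)
      moreover have "insert_index (Suc i) 0 = 0" by (simp add: insert_index_def)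
      ultimately show ?thesis using a by (subst det_fmat_pivot) (auto simp: s_def)
    qed
    then have "a 0 0 * (a (Suc i) (Suc i) * ?s) = a (Suc i) (Suc i) *
        det (fmat (Suc n) (\<lambda>p q. a (insert_index (Suc i) p) (insert_index (Suc i) q)))"
      by (simp add: mult.left_commute)
    finally show ?thesis .
  qed
  show ?case
  proof (cases i)
    case (Suc i')
    with pos Suc.prems show ?thesis by auto
  next
    case i0: 0
    \<comment> \<open>The reversal moves index 0 to the last index \<open>Suc n\<close>, which is
      positive and hence covered by \<open>pos\<close>.\<close>
    define r where "r = (\<lambda>i j. a (Suc n - i) (Suc n - j))"
    have r: "TP_fun (Suc (Suc n)) r"
      using TP_fun_reverse[OF Suc.prems(1)] by (simp add: r_def)
    have dr: "det (fmat (Suc (Suc n)) r) = det (fmat (Suc (Suc n)) a)"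
      using det_fmat_reverse[of "Suc (Suc n)" a] by (simp add: r_def)
    have "det (fmat (Suc (Suc n)) r) \<le> r (Suc n) (Suc n) *
        det (fmat (Suc n) (\<lambda>p q. r (insert_index (Suc n) p) (insert_index (Suc n) q)))"
      using pos[OF r, of n] dr Suc.prems(2) by simp
    also have "fmat (Suc n) (\<lambda>p q. r (insert_index (Suc n) p) (insert_index (Suc n) q)) =
        fmat (Suc n) (\<lambda>p q. a (Suc (Suc n - 1 - p)) (Suc (Suc n - 1 - q)))"
      by (auto simp: r_def insert_index_def Suc_diff_le less_Suc_eq_le)
    also have "det \<dots> = det (fmat (Suc n) (\<lambda>p q. a (Suc p) (Suc q)))"
      by (rule det_fmat_reverse)
    also have "(\<lambda>p q. a (Suc p) (Suc q)) = (\<lambda>p q. a (insert_index i p) (insert_index i q))"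
      by (simp add: i0 insert_index_def)
    finally show ?thesis using dr i0 by (simp add: r_def)
  qed
qed

lemma index_mult_mat_sum:
  assumes "A \<in> carrier_mat n m" "B \<in> carrier_mat m l" "i < n" "j < l"
  shows "(A * B) $$ (i, j) = (\<Sum>k<m. A $$ (i, k) * B $$ (k, j))"
  using assms by (auto simp: scalar_prod_def atLeast0LessThan intro!: sum.cong)

lemma mat_delete_fmat:
  "i < n \<Longrightarrow> j < n \<Longrightarrow>
    mat_delete (fmat n a) i j = fmat (n - 1) (\<lambda>p q. a (insert_index i p) (insert_index j q))"
  by (rule eq_matI) (auto simp: mat_delete_def insert_index_def)

subsection \<open>Eigenvalues of totally positive matrices are nonnegative\<close>

text \<open>Only row \<open>m\<close> changes, so the cofactors along that row stay the same and
  Laplace expansion is affine in \<open>x\<close>.\<close>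

lemma det_fmat_add_diag_entry:
  fixes a :: "nat \<Rightarrow> nat \<Rightarrow> 'a::comm_ring_1"
  assumes m: "m < Suc n"
  shows "det (fmat (Suc n) (\<lambda>i j. a i j + (if i = m \<and> j = m then x else 0))) =
    det (fmat (Suc n) a) + x * det (fmat n (\<lambda>p q. a (insert_index m p) (insert_index m q)))"
proof -
  let ?b = "fmat (Suc n) (\<lambda>i j. a i j + (if i = m \<and> j = m then x else 0))"
  have del: "mat_delete ?b m j = mat_delete (fmat (Suc n) a) m j" for j
    by (auto simp: mat_delete_def)
  have "det ?b = (\<Sum>j<Suc n. ?b $$ (m, j) * cofactor ?b m j)"
    by (rule laplace_expansion_row) (use m in auto)
  also have "\<dots> = (\<Sum>j<Suc n. a m j * cofactor (fmat (Suc n) a) m j +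
      (if j = m then x * cofactor (fmat (Suc n) a) m m else 0))"
    using m by (intro sum.cong) (auto simp: cofactor_def del algebra_simps)
  also have "\<dots> = (\<Sum>j<Suc n. a m j * cofactor (fmat (Suc n) a) m j) + x * cofactor (fmat (Suc n) a) m m"
    using m by (subst sum.distrib) (simp add: sum.delta)
  also have "(\<Sum>j<Suc n. a m j * cofactor (fmat (Suc n) a) m j) = det (fmat (Suc n) a)"
    using m by (subst laplace_expansion_row[of _ "Suc n" m]) auto
  also have "cofactor (fmat (Suc n) a) m m = det (fmat n (\<lambda>p q. a (insert_index m p) (insert_index m q)))"
    by (auto simp: cofactor_def mat_delete_def insert_index_def simp flip: mult_2 intro!: arg_cong[of _ _ det])
  finally show ?thesis .
qed

text \<open>The shift is added to one diagonal entry at a time. Each addition contributes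
  \<open>x\<close> times a principal minor that is itself shifted, so nonnegativity follows by
  induction on \<open>m\<close>. For \<open>m = n\<close> this contribution is strictly positive,
  going back to the empty determinant 1.\<close>

lemma det_add_diag_principal_minors:
  fixes a :: "nat \<Rightarrow> nat \<Rightarrow> real"
  assumes "\<And>k f. incr_index k n f \<Longrightarrow> det (fmat k (\<lambda>i j. a (f i) (f j))) \<ge> 0"
    and "m \<le> n" and x: "x > 0"
  shows "det (fmat n (\<lambda>i j. a i j + (if i = j \<and> i < m then x else 0))) \<ge> 0 \<and>
    (m = n \<longrightarrow> det (fmat n (\<lambda>i j. a i j + (if i = j \<and> i < m then x else 0))) > 0)"
  using assms(1,2)
proof (induction m arbitrary: n a)
  case 0
  from 0(1)[OF incr_index_id] show ?case
    by auto
next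
  case (Suc m n a)
  then obtain n' where n: "n = Suc n'" and m: "m \<le> n'" by (cases n) auto
  let ?b = "\<lambda>i j. a i j + (if i = j \<and> i < m then x else 0)"
  let ?c = "\<lambda>p q. a (insert_index m p) (insert_index m q)"
  have eq1: "fmat n (\<lambda>i j. a i j + (if i = j \<and> i < Suc m then x else 0)) =
      fmat n (\<lambda>i j. ?b i j + (if i = m \<and> j = m then x else 0))"
    by (intro cong_mat) (auto simp: less_Suc_eq)
  have eq2: "det (fmat n (\<lambda>i j. ?b i j + (if i = m \<and> j = m then x else 0))) =
      det (fmat n ?b) + x * det (fmat n' (\<lambda>p q. ?b (insert_index m p) (insert_index m q)))"
    unfolding n by (rule det_fmat_add_diag_entry) (use m in auto)
  \<comment> \<open>Deleting row and column \<open>m\<close> leaves the shift on exactly the first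
    \<open>m\<close> diagonal positions, the shape that the induction hypothesis requires.\<close>
  have "insert_index m p = insert_index m q \<longleftrightarrow> p = q" "insert_index m p < m \<longleftrightarrow> p < m" for p q
    by (auto simp: insert_index_def)
  then have eq: "det (fmat n (\<lambda>i j. a i j + (if i = j \<and> i < Suc m then x else 0))) =
     det (fmat n ?b) + x * det (fmat n' (\<lambda>p q. ?c p q + (if p = q \<and> p < m then x else 0)))"
    unfolding eq1 eq2 by simp
  have 1: "det (fmat n ?b) \<ge> 0"
    using Suc.IH[of n a] Suc.prems by auto
  have "det (fmat k (\<lambda>i j. ?c (f i) (f j))) \<ge> 0" if "incr_index k n' f" for k f
    using incr_index_comp[OF that incr_index_insert_index[of n' m]] Suc.prems(1)[of k "\<lambda>i. insert_index m (f i)"]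
    by (simp add: n)
  from Suc.IH[of n' ?c, OF this m]
  show ?case unfolding eq using 1 x n
    by (auto simp: add_nonneg_pos)
qed

text \<open>For \<open>k < 0\<close> the matrix \<open>A - k I\<close> is a positive diagonal shift
  of \<open>A\<close>, so its determinant is positive and \<open>k\<close> cannot be an
  eigenvalue.\<close>

lemma TP_mat_eigenvalue_nonneg:
  assumes A: "A \<in> carrier_mat n n" and tp: "TP_fun n (\<lambda>i j. A $$ (i, j))" and k: "eigenvalue A k"
  shows "k \<ge> 0"
proof (rule ccontr)
  assume "\<not> k \<ge> 0"
  then have "- k > 0" by simp
  have "det (fmat l (\<lambda>i j. A $$ (f i, f j))) \<ge> 0" if "incr_index l n f" for l f
    using tp that by (auto simp: TP_fun_def)
  from det_add_diag_principal_minors[of n "\<lambda>i j. A $$ (i, j)", OF this order.refl \<open>- k > 0\<close>]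
  have "det (fmat n (\<lambda>i j. A $$ (i, j) + (if i = j \<and> i < n then - k else 0))) > 0" by auto
  also have "fmat n (\<lambda>i j. A $$ (i, j) + (if i = j \<and> i < n then - k else 0)) = char_matrix A k"
    using A by (auto simp: char_matrix_def)
  finally show False using k eigenvalue_det[OF A] by simp
qed

subsection \<open>Eigenvalues of nonnegative matrices\<close>

lemma continuous_on_det:
  fixes g :: "nat \<Rightarrow> nat \<Rightarrow> 'b::topological_space \<Rightarrow> real"
  assumes "\<And>i j. i < n \<Longrightarrow> j < n \<Longrightarrow> continuous_on S (g i j)"
  shows "continuous_on S (\<lambda>x. det (fmat n (\<lambda>i j. g i j x)))"
proof -
  have "continuous_on S (\<lambda>x. \<Sum>p\<in>{p. p permutes {0..<n}}. signof p * (\<Prod>i=0..<n. g i (p i) x))"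
    using assms by (intro continuous_intros) (auto simp: permutes_in_image)
  also have "(\<lambda>x. \<Sum>p\<in>{p. p permutes {0..<n}}. signof p * (\<Prod>i=0..<n. g i (p i) x)) =
      (\<lambda>x. det (fmat n (\<lambda>i j. g i j x)))"
    by (rule ext, subst det_def'[of _ n])
      (auto simp: permutes_in_image intro!: sum.cong prod.cong arg_cong2[of _ _ _ _ "(*)"])
  finally show ?thesis .
qed

lemma continuous_on_Min_image:
  fixes g :: "'i \<Rightarrow> 'b::topological_space \<Rightarrow> real"
  assumes "finite I" "I \<noteq> {}" "\<And>i. i \<in> I \<Longrightarrow> continuous_on S (g i)"
  shows "continuous_on S (\<lambda>x. Min ((\<lambda>i. g i x) ` I))"
  using assms by (induction I rule: finite_ne_induct) (auto intro: continuous_on_min)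

text \<open>If \<open>P\<close> had no eigenvalue in \<open>[\<mu>, \<infinity>)\<close>, the solution \<open>w x\<close> of \<open>(x I - P) w = 1\<close> would depend
  continuously on \<open>x \<ge> \<mu>\<close>. Its least entry is positive for large \<open>x\<close> and is never \<open>0\<close>, hence
  \<open>w \<mu> > 0\<close>, which is incompatible with \<open>P y \<ge> \<mu> y\<close>.\<close>

lemma nonneg_mat_eigenvalue_ge:
  fixes P :: "real mat" and y :: "nat \<Rightarrow> real"
  assumes P: "P \<in> carrier_mat n n" and P_nonneg: "\<And>i j. i < n \<Longrightarrow> j < n \<Longrightarrow> P $$ (i, j) \<ge> 0"
    and y: "\<And>i. i < n \<Longrightarrow> y i \<ge> 0" and i0: "i0 < n" "y i0 > 0"
    and Py: "\<And>i. i < n \<Longrightarrow> \<mu> * y i \<le> (\<Sum>j<n. P $$ (i, j) * y j)"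
  shows "\<exists>\<nu>\<ge>\<mu>. eigenvalue P \<nu>"
proof (rule ccontr)
  assume no: "\<not> (\<exists>\<nu>\<ge>\<mu>. eigenvalue P \<nu>)"
  have n: "{..<n} \<noteq> {}" using i0 by auto
  define c where "c = (\<lambda>i j x. P $$ (i, j) - (if i = j then x else 0))"
  define C where "C = (\<lambda>x. fmat n (\<lambda>i j. c i j x))"
  have C: "C x \<in> carrier_mat n n" for x by (simp add: C_def)
  have "C x = char_matrix P x" for x
    using P by (auto simp: C_def c_def char_matrix_def)
  then have det_C: "det (C x) \<noteq> 0" if "x \<ge> \<mu>" for x
    using no that eigenvalue_det[OF P] by auto
  \<comment> \<open>Cramer's rule for \<open>(x I - P) w = 1\<close>, with the minus sign because
    \<open>C x\<close> is \<open>P - x I\<close>. Written through the adjugate, \<open>w\<close> is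
    visibly continuous wherever \<open>det (C x)\<close> is nonzero.\<close>
  define w where "w = (\<lambda>i x. - (\<Sum>j<n. adj_mat (C x) $$ (i, j)) / det (C x))"
  have w: "(\<Sum>j<n. P $$ (i, j) * w j x) = x * w i x - 1" if i: "i < n" and x: "x \<ge> \<mu>" for i x
  proof -
    have "(\<Sum>j<n. C x $$ (i, j) * adj_mat (C x) $$ (j, l)) = (if i = l then det (C x) else 0)"
      if "l < n" for l
    proof -
      have "(C x * adj_mat (C x)) $$ (i, l) = (\<Sum>j<n. C x $$ (i, j) * adj_mat (C x) $$ (j, l))"
        by (rule index_mult_mat_sum[OF C adj_mat(1)[OF C] i that])
      then show ?thesis using i that by (cases "i = l") (simp_all add: adj_mat(2)[OF C])
    qed
    then have "(\<Sum>l<n. \<Sum>j<n. C x $$ (i, j) * adj_mat (C x) $$ (j, l)) = det (C x)"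
      using i by (simp add: sum.delta)
    then have "(\<Sum>j<n. C x $$ (i, j) * (\<Sum>l<n. adj_mat (C x) $$ (j, l))) = det (C x)"
      by (subst (asm) sum.swap) (simp add: sum_distrib_left)
    moreover have "(\<Sum>j<n. C x $$ (i, j) * w j x) =
        - (\<Sum>j<n. C x $$ (i, j) * (\<Sum>l<n. adj_mat (C x) $$ (j, l))) / det (C x)"
      by (simp add: w_def sum_divide_distrib[symmetric] sum_negf)
    ultimately have "-1 = (\<Sum>j<n. C x $$ (i, j) * w j x)"
      using det_C[OF x] by simp
    also have "\<dots> = (\<Sum>j<n. P $$ (i, j) * w j x - (if i = j then x * w i x else 0))"
      using i by (intro sum.cong) (auto simp: C_def c_def left_diff_distrib)
    also have "\<dots> = (\<Sum>j<n. P $$ (i, j) * w j x) - x * w i x"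
      using i by (simp add: sum_subtractf)
    finally show ?thesis by simp
  qed
  have cont_c: "continuous_on {\<mu>..} (c i j)" for i j
    unfolding c_def by (cases "i = j") (auto intro!: continuous_intros)
  have cont_w: "continuous_on {\<mu>..} (w i)" if i: "i < n" for i
  proof -
    have det: "continuous_on {\<mu>..} (\<lambda>x. det (C x))"
      unfolding C_def by (rule continuous_on_det) (rule cont_c)
    have adj: "continuous_on {\<mu>..} (\<lambda>x. adj_mat (C x) $$ (i, j))" if j: "j < n" for j
    proof -
      have "continuous_on {\<mu>..} (\<lambda>x. (-1) ^ (j + i) *
          det (fmat (n - 1) (\<lambda>p q. c (insert_index j p) (insert_index i q) x)))"
        by (intro continuous_intros continuous_on_det cont_c)
      then show ?thesis using i j
        by (simp add: adj_mat_def C_def cofactor_def mat_delete_fmat)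
    qed
    show ?thesis unfolding w_def
      using det_C by (intro continuous_intros det adj) auto
  qed
  define h where "h = (\<lambda>x. Min ((\<lambda>i. w i x) ` {..<n}))"
  have h_le: "h x \<le> w i x" if "i < n" for i x
    unfolding h_def using that by (intro Min_le) auto
  have h_attained: "\<exists>i<n. h x = w i x" for x
  proof -
    have "h x \<in> (\<lambda>i. w i x) ` {..<n}" unfolding h_def by (rule Min_in) (use n in auto)
    then show ?thesis by auto
  qed
  \<comment> \<open>If the least entry were 0, all of \<open>w\<close> would be nonnegative, yet in
    the row attaining it \<open>P w = x w - 1\<close> would equal -1.\<close>
  have h_nz: "h x \<noteq> 0" if x: "x \<ge> \<mu>" for x
  proof
    assume h: "h x = 0"
    obtain i where i: "i < n" "w i x = 0" using h_attained[of x] h by auto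
    have "(\<Sum>j<n. P $$ (i, j) * w j x) \<ge> 0"
      using h_le[of _ x] h P_nonneg i by (intro sum_nonneg mult_nonneg_nonneg) auto
    with w[OF i(1) x] i(2) show False by simp
  qed
  \<comment> \<open>This point is at least \<open>\<mu>\<close> and at least every row sum of
    \<open>P\<close>, so at the least entry \<open>w i\<close> the factor \<open>x1\<close> minus
    row sum is nonnegative while its product with \<open>w i\<close> is at least 1.\<close>
  define x1 where "x1 = \<bar>\<mu>\<bar> + (\<Sum>i<n. \<Sum>j<n. P $$ (i, j))"
  have "h x1 > 0"
  proof (rule ccontr)
    assume "\<not> h x1 > 0"
    obtain i where i: "i < n" "h x1 = w i x1" using h_attained by blast
    have S_nonneg: "(\<Sum>j<n. P $$ (l, j)) \<ge> 0" if "l < n" for l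
      using that P_nonneg by (intro sum_nonneg) auto
    have row: "(\<Sum>j<n. P $$ (i, j)) \<le> (\<Sum>i<n. \<Sum>j<n. P $$ (i, j))"
      using i S_nonneg by (intro member_le_sum) auto
    moreover have "x1 \<ge> \<mu>"
      using S_nonneg[OF i(1)] row by (simp add: x1_def)
    note w[OF i(1) this]
    moreover have "(\<Sum>j<n. P $$ (i, j)) * w i x1 \<le> (\<Sum>j<n. P $$ (i, j) * w j x1)"
      unfolding sum_distrib_right using h_le[of _ x1] P_nonneg i
      by (intro sum_mono mult_left_mono) auto
    ultimately have "(x1 - (\<Sum>j<n. P $$ (i, j))) * w i x1 \<ge> 1"
      by (simp add: left_diff_distrib)
    moreover have "(x1 - (\<Sum>j<n. P $$ (i, j))) * w i x1 \<le> 0"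
      using row \<open>\<not> h x1 > 0\<close> i by (intro mult_nonneg_nonpos) (auto simp: x1_def)
    ultimately show False by simp
  qed
  have x1: "x1 \<ge> \<mu>"
    using P_nonneg by (auto simp: x1_def intro!: add_increasing2 sum_nonneg)
  have h_pos: "h \<mu> > 0"
  proof (rule ccontr)
    assume "\<not> h \<mu> > 0"
    moreover have "continuous_on {\<mu>..x1} h"
      unfolding h_def using n
      by (intro continuous_on_Min_image) (auto intro: continuous_on_subset[OF cont_w])
    ultimately obtain x where "\<mu> \<le> x" "h x = 0"
      using IVT'[of h \<mu> 0 x1] \<open>h x1 > 0\<close> x1 by auto
    with h_nz show False by blast
  qed
  \<comment> \<open>The smallest scalar with \<open>y \<le> r w\<close>. At an index
    \<open>k\<close> of equality, the row equation for \<open>w\<close> gives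
    \<open>\<mu> * y k \<le> \<mu> * y k - r\<close>, which contradicts
    \<open>r > 0\<close>.\<close>
  define r where "r = Max ((\<lambda>i. y i / w i \<mu>) ` {..<n})"
  have w_pos: "w i \<mu> > 0" if "i < n" for i
    using h_le[OF that, of \<mu>] h_pos by simp
  have y_le: "y i \<le> r * w i \<mu>" if "i < n" for i
  proof -
    have "y i / w i \<mu> \<le> r" unfolding r_def using that by (intro Max_ge) auto
    with w_pos[OF that] show ?thesis by (simp add: pos_divide_le_eq)
  qed
  have "r > 0"
    using y_le[OF i0(1)] i0(2) w_pos[OF i0(1)] by (auto dest: order.strict_trans2 simp: zero_less_mult_iff)
  have "r \<in> (\<lambda>i. y i / w i \<mu>) ` {..<n}" unfolding r_def by (rule Max_in) (use n in auto)
  then obtain k where k: "k < n" "r = y k / w k \<mu>" by auto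
  have "\<mu> * y k \<le> (\<Sum>j<n. P $$ (k, j) * y j)" by (rule Py[OF k(1)])
  also have "\<dots> \<le> (\<Sum>j<n. P $$ (k, j) * (r * w j \<mu>))"
    using y_le P_nonneg k by (intro sum_mono mult_left_mono) auto
  also have "\<dots> = r * (\<Sum>j<n. P $$ (k, j) * w j \<mu>)"
    by (simp add: sum_distrib_left mult.left_commute)
  also have "\<dots> = r * (\<mu> * w k \<mu> - 1)"
    by (simp add: w[OF k(1)])
  also have "\<dots> = \<mu> * y k - r"
    using w_pos[OF k(1)] k(2) by (simp add: field_simps)
  finally show False using \<open>r > 0\<close> by simp
qed

subsection \<open>Inverses of totally positive matrices\<close>

text \<open>Multiplying \<open>adj_mat A * A = det A I\<close> by \<open>B\<close> on the right
  gives \<open>det A B = adj_mat A\<close>.\<close>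

lemma inverse_mat_entry:
  fixes A :: "'a::field mat"
  assumes A: "A \<in> carrier_mat n n" and B: "B \<in> carrier_mat n n" and AB: "A * B = 1\<^sub>m n"
    and ij: "i < n" "j < n"
  shows "det A * B $$ (i, j) = cofactor A j i"
proof -
  have "det A \<cdot>\<^sub>m B = (adj_mat A * A) * B"
    using mult_smult_assoc_mat[of "1\<^sub>m n" n n B n "det A"] B by (simp add: adj_mat(3)[OF A])
  also have "\<dots> = adj_mat A * (A * B)"
    using A B adj_mat(1)[OF A] by (intro assoc_mult_mat)
  also have "\<dots> = adj_mat A"
    using adj_mat(1)[OF A] by (simp add: AB)
  finally have "(det A \<cdot>\<^sub>m B) $$ (i, j) = adj_mat A $$ (i, j)" by simp
  then show ?thesis using A B ij by (simp add: adj_mat_def)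
qed

lemma det_nonzero_of_inverse:
  fixes A :: "'a::field mat"
  assumes "A \<in> carrier_mat n n" "B \<in> carrier_mat n n" "A * B = 1\<^sub>m n"
  shows "det A \<noteq> 0"
  using det_mult[OF assms(1,2)] assms(3) by auto

lemma cofactor_fmat:
  "i < n \<Longrightarrow> j < n \<Longrightarrow> cofactor (fmat n a) i j =
    (-1) ^ (i + j) * det (fmat (n - 1) (\<lambda>p q. a (insert_index i p) (insert_index j q)))"
  by (simp add: cofactor_def mat_delete_fmat)

lemma fmat_eq: "A \<in> carrier_mat n n \<Longrightarrow> mat n n (($$) A) = A"
  by auto

text \<open>The checkerboard sign cancels the sign in the cofactor, leaving a nonnegative minor
  divided by a positive determinant.\<close>

lemma TP_inverse_checkerboard_nonneg:
  assumes A: "A \<in> carrier_mat n n" and B: "B \<in> carrier_mat n n" and AB: "A * B = 1\<^sub>m n"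
    and tp: "TP_fun n (\<lambda>i j. A $$ (i, j))" and ij: "i < n" "j < n"
  shows "(-1) ^ (i + j) * B $$ (i, j) \<ge> 0"
proof -
  let ?d = "det (fmat (n - 1) (\<lambda>p q. A $$ (insert_index j p, insert_index i q)))"
  have d: "det A > 0"
    using TP_fun_det[OF tp] det_nonzero_of_inverse[OF A B AB] by (simp add: fmat_eq[OF A])
  have n: "Suc (n - 1) = n" using ij by simp
  have "incr_index (n - 1) n (insert_index l)" for l
    using incr_index_insert_index[of "n - 1" l] unfolding n .
  then have "?d \<ge> 0"
    using tp by (simp add: TP_fun_def)
  moreover have "det A * ((-1) ^ (i + j) * B $$ (i, j)) = ?d"
  proof -
    have "det A * B $$ (i, j) = (-1) ^ (i + j) * ?d"
      using inverse_mat_entry[OF A B AB ij] cofactor_fmat[OF ij(2,1), of "\<lambda>i j. A $$ (i, j)"]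
      by (simp add: fmat_eq[OF A] add.commute)
    then have "det A * ((-1) ^ (i + j) * B $$ (i, j)) = ((-1) ^ (i + j) * (-1) ^ (i + j)) * ?d"
      by (simp only: mult.left_commute[of "det A"] mult.assoc)
    then show ?thesis by (simp only: minus_one_mult_self mult_1)
  qed
  ultimately show ?thesis
    using d mult_le_cancel_left_pos[of "det A" 0 "(-1) ^ (i + j) * B $$ (i, j)"] by simp
qed

text \<open>The chain is \<open>det A \<le> A $$ (i, i) * ?d \<le> ?d = det A * B $$ (i, i)\<close>,
  where \<open>?d\<close> is the complementary principal minor.\<close>

lemma TP_inverse_diag_ge_1:
  assumes A: "A \<in> carrier_mat n n" and B: "B \<in> carrier_mat n n" and AB: "A * B = 1\<^sub>m n"
    and tp: "TP_fun n (\<lambda>i j. A $$ (i, j))" and i: "i < n" and le: "A $$ (i, i) \<le> 1"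
  shows "B $$ (i, i) \<ge> 1"
proof -
  let ?d = "det (fmat (n - 1) (\<lambda>p q. A $$ (insert_index i p, insert_index i q)))"
  have n: "Suc (n - 1) = n" using i by simp
  have d: "det A > 0"
    using TP_fun_det[OF tp] det_nonzero_of_inverse[OF A B AB] by (simp add: fmat_eq[OF A])
  have "incr_index (n - 1) n (insert_index i)"
    using incr_index_insert_index[of "n - 1" i] unfolding n .
  then have "?d \<ge> 0"
    using tp by (simp add: TP_fun_def)
  have "det A \<le> A $$ (i, i) * ?d"
    using TP_fun_det_le_diag[of "n - 1" "\<lambda>i j. A $$ (i, j)" i] tp i d by (simp add: n fmat_eq[OF A])
  also have "\<dots> \<le> ?d"
    using mult_right_mono[OF le \<open>?d \<ge> 0\<close>] by simp
  also have "?d = det A * B $$ (i, i)"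
    using inverse_mat_entry[OF A B AB i i] cofactor_fmat[OF i i, of "\<lambda>i j. A $$ (i, j)"]
    by (simp add: fmat_eq[OF A] flip: mult_2)
  finally show ?thesis using d by simp
qed

text \<open>Conjugation by \<open>diag (1, -1, 1, ...)\<close> respects products: the two signs at
  the middle index \<open>l\<close> cancel.\<close>

lemma minus_one_power_cancel:
  "(-1) ^ (i + l) * (-1) ^ (l + j) = ((-1) ^ (i + j) :: 'a::comm_ring_1)"
proof -
  have "(-1) ^ (i + l) * (-1) ^ (l + j) = (-1) ^ (i + j) * ((-1) ^ l * (-1) ^ l :: 'a)"
    by (simp only: power_add mult_ac)
  then show ?thesis by (simp only: minus_one_mult_self) simp
qed

subsection \<open>Comparison of least eigenvalues\<close>

lemma nonzero_vec_entry:
  assumes "x \<in> carrier_vec n" "x \<noteq> 0\<^sub>v n"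
  obtains i where "i < n" "x $ i \<noteq> 0"
  using assms by (metis carrier_vecD eq_vecI index_zero_vec)

text \<open>With \<open>P = J A' J\<close>, an eigenvector \<open>y\<close> of \<open>M\<close>
  satisfies \<open>|y| / k \<le> P |y|\<close>. Hence the nonnegative matrix \<open>P\<close> has an
  eigenvalue \<open>\<nu> \<ge> 1 / k\<close>, and \<open>1 / \<nu> \<le> k\<close> is an eigenvalue
  of \<open>A\<close>.\<close>

lemma eigenvalue_le_of_inverse_le:
  fixes A M A' M' :: "real mat"
  assumes car: "A \<in> carrier_mat n n" "A' \<in> carrier_mat n n" "M \<in> carrier_mat n n" "M' \<in> carrier_mat n n"
    and inv: "A * A' = 1\<^sub>m n" "M' * M = 1\<^sub>m n"
    and M'_nonneg: "\<And>i j. i < n \<Longrightarrow> j < n \<Longrightarrow> 0 \<le> (-1) ^ (i + j) * M' $$ (i, j)"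
    and M'_le: "\<And>i j. i < n \<Longrightarrow> j < n \<Longrightarrow> (-1) ^ (i + j) * M' $$ (i, j) \<le> (-1) ^ (i + j) * A' $$ (i, j)"
    and k: "eigenvalue M k" "k > 0"
  shows "\<exists>k'\<le>k. eigenvalue A k'"
proof -
  define P where "P = fmat n (\<lambda>i j. (-1) ^ (i + j) * A' $$ (i, j))"
  have P: "P \<in> carrier_mat n n" by (simp add: P_def)
  obtain y where y: "y \<in> carrier_vec n" "y \<noteq> 0\<^sub>v n" "M *\<^sub>v y = k \<cdot>\<^sub>v y"
    using k(1) car by (auto simp: eigenvalue_def eigenvector_def)
  have "y = M' *\<^sub>v (M *\<^sub>v y)"
    using car y inv by (subst assoc_mult_mat_vec[symmetric]) auto
  also have "\<dots> = k \<cdot>\<^sub>v (M' *\<^sub>v y)"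
    using car y by (simp add: mult_mat_vec)
  finally have y_eq: "y = k \<cdot>\<^sub>v (M' *\<^sub>v y)" .
  have y_le: "1 / k * \<bar>y $ i\<bar> \<le> (\<Sum>j<n. P $$ (i, j) * \<bar>y $ j\<bar>)" if i: "i < n" for i
  proof -
    have "y $ i = k * (\<Sum>j<n. M' $$ (i, j) * y $ j)"
      using i car y by (subst y_eq) (simp add: scalar_prod_def atLeast0LessThan)
    then have "1 / k * \<bar>y $ i\<bar> = \<bar>\<Sum>j<n. M' $$ (i, j) * y $ j\<bar>"
      using k(2) by (simp add: abs_mult)
    also have "\<dots> \<le> (\<Sum>j<n. \<bar>M' $$ (i, j) * y $ j\<bar>)"
      by (rule sum_abs)
    also have "\<dots> \<le> (\<Sum>j<n. P $$ (i, j) * \<bar>y $ j\<bar>)"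
    proof (rule sum_mono)
      fix j assume "j \<in> {..<n}"
      then have j: "j < n" by simp
      have "\<bar>M' $$ (i, j)\<bar> = (-1) ^ (i + j) * M' $$ (i, j)"
        using abs_of_nonneg[OF M'_nonneg[OF i j]] by (simp add: abs_mult power_abs)
      also have "\<dots> \<le> P $$ (i, j)"
        using M'_le[OF i j] i j by (simp add: P_def)
      finally show "\<bar>M' $$ (i, j) * y $ j\<bar> \<le> P $$ (i, j) * \<bar>y $ j\<bar>"
        by (simp add: abs_mult mult_right_mono)
    qed
    finally show ?thesis .
  qed
  obtain i0 where i0: "i0 < n" "y $ i0 \<noteq> 0"
    using y(1,2) by (rule nonzero_vec_entry)
  have "P $$ (i, j) \<ge> 0" if "i < n" "j < n" for i j
    using M'_nonneg[OF that] M'_le[OF that] that by (simp add: P_def)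
  from nonneg_mat_eigenvalue_ge[OF P this, of "\<lambda>i. \<bar>y $ i\<bar>" i0 "1 / k"] y_le i0
  obtain \<nu> where \<nu>: "\<nu> \<ge> 1 / k" "eigenvalue P \<nu>" by auto
  then have \<nu>_pos: "\<nu> > 0" using k(2) by (auto intro: order.strict_trans2[of 0 "1 / k"])
  obtain z where z: "z \<in> carrier_vec n" "z \<noteq> 0\<^sub>v n" "P *\<^sub>v z = \<nu> \<cdot>\<^sub>v z"
    using \<nu>(2) P by (auto simp: eigenvalue_def eigenvector_def)
  \<comment> \<open>This is \<open>J z\<close>: undoing the conjugation turns an eigenvector of
    \<open>P\<close> into one of \<open>A'\<close>.\<close>
  define x where "x = vec n (\<lambda>i. (-1) ^ i * z $ i)"
  have x: "x \<in> carrier_vec n" by (simp add: x_def)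
  obtain i1 where "i1 < n" "z $ i1 \<noteq> 0"
    using z(1,2) by (rule nonzero_vec_entry)
  then have "x $ i1 \<noteq> 0\<^sub>v n $ i1" by (simp add: x_def)
  then have "x \<noteq> 0\<^sub>v n" by metis
  have "A' *\<^sub>v x = \<nu> \<cdot>\<^sub>v x"
  proof (rule eq_vecI)
    fix i assume "i < dim_vec (\<nu> \<cdot>\<^sub>v x)"
    then have i: "i < n" by (simp add: x_def)
    have "(A' *\<^sub>v x) $ i = (\<Sum>j<n. A' $$ (i, j) * ((-1) ^ j * z $ j))"
      using i car x by (simp add: scalar_prod_def atLeast0LessThan x_def)
    also have "\<dots> = (\<Sum>j<n. (-1) ^ i * (P $$ (i, j) * z $ j))"
      using i by (intro sum.cong) (auto simp: P_def power_add mult.assoc[symmetric])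
    also have "\<dots> = (-1) ^ i * (P *\<^sub>v z) $ i"
      using i P z(1) by (simp add: scalar_prod_def atLeast0LessThan sum_distrib_left)
    also have "\<dots> = (\<nu> \<cdot>\<^sub>v x) $ i"
      using i z(1) by (simp add: z(3) x_def)
    finally show "(A' *\<^sub>v x) $ i = (\<nu> \<cdot>\<^sub>v x) $ i" .
  qed (use car x in auto)
  then have "A *\<^sub>v (A' *\<^sub>v x) = \<nu> \<cdot>\<^sub>v (A *\<^sub>v x)"
    using car x by (simp add: mult_mat_vec)
  moreover have "A *\<^sub>v (A' *\<^sub>v x) = x"
    using car x inv by (subst assoc_mult_mat_vec[symmetric]) auto
  ultimately have "A *\<^sub>v x = (1 / \<nu>) \<cdot>\<^sub>v x"
    using \<nu>_pos car x by (metis (no_types, lifting) less_numeral_extra(3) nonzero_eq_divide_eq one_smult_vec smult_smult_assoc)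
  then have "eigenvalue A (1 / \<nu>)"
    using \<open>x \<noteq> 0\<^sub>v n\<close> x car by (auto simp: eigenvalue_def eigenvector_def)
  moreover have "1 / \<nu> \<le> k"
    using \<nu>(1) \<nu>_pos k(2) by (simp add: field_simps)
  ultimately show ?thesis by blast
qed

lemma eigenvalue_0_iff:
  fixes A :: "'a::field mat"
  assumes A: "A \<in> carrier_mat n n"
  shows "eigenvalue A 0 \<longleftrightarrow> det A = 0"
proof -
  have "char_matrix A 0 = A" using A by (auto simp: char_matrix_def)
  then show ?thesis using eigenvalue_det[OF A, of 0] by simp
qed

lemma finite_eigenvalues:
  fixes A :: "'a::field mat"
  shows "A \<in> carrier_mat n n \<Longrightarrow> finite {k. eigenvalue A k}"
  using card_finite_spectrum(1)[of A n] by (simp add: spectrum_def)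

text \<open>The all-ones vector with bound 0 is a suitable test vector. The lemma ensures that the
  minima for \<open>M\<close> are taken over nonempty sets.\<close>

lemma nonneg_mat_eigenvalue_ex:
  fixes P :: "real mat"
  assumes "P \<in> carrier_mat n n" "n > 0" "\<And>i j. i < n \<Longrightarrow> j < n \<Longrightarrow> P $$ (i, j) \<ge> 0"
  shows "{k. eigenvalue P k} \<noteq> {}"
proof -
  have "\<exists>\<nu>\<ge>0. eigenvalue P \<nu>"
    by (rule nonneg_mat_eigenvalue_ge[of P n "\<lambda>_. 1" 0 0]) (use assms in \<open>auto intro: sum_nonneg\<close>)
  then show ?thesis by auto
qed

text \<open>For an eigenvector \<open>y\<close>, \<open>k (y, y) = (A y, A y)\<close>, and
  \<open>(y, y)\<close> is positive.\<close>

lemma gram_eigenvalue_nonneg: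
  fixes A :: "real mat"
  assumes A: "A \<in> carrier_mat n n" and k: "eigenvalue (transpose_mat A * A) k"
  shows "k \<ge> 0"
proof -
  obtain y where y: "y \<in> carrier_vec n" "y \<noteq> 0\<^sub>v n" "(transpose_mat A * A) *\<^sub>v y = k \<cdot>\<^sub>v y"
    using k A by (auto simp: eigenvalue_def eigenvector_def)
  have nonneg: "x \<bullet> x \<ge> 0" for x :: "real vec"
    by (auto simp: scalar_prod_def intro: sum_nonneg)
  obtain i where "i < n" "y $ i \<noteq> 0"
    using y(1,2) by (rule nonzero_vec_entry)
  then have "y \<bullet> y > 0"
    using y(1) unfolding scalar_prod_def by (intro sum_pos2[of _ i]) (auto simp: zero_less_mult_iff linorder_neq_iff)
  have "k * (y \<bullet> y) = ((transpose_mat A * A) *\<^sub>v y) \<bullet> y"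
    using y by simp
  also have "(transpose_mat A * A) *\<^sub>v y = transpose_mat A *\<^sub>v (A *\<^sub>v y)"
    using A y by (intro assoc_mult_mat_vec) auto
  also have "\<dots> \<bullet> y = (A *\<^sub>v y) \<bullet> (A *\<^sub>v y)"
    using A y by (intro transpose_vec_mult_scalar) auto
  finally have "k * (y \<bullet> y) \<ge> 0" using nonneg by simp
  then show ?thesis using \<open>y \<bullet> y > 0\<close> by (simp add: zero_le_mult_iff)
qed

text \<open>Applied with \<open>f\<close> the identity for eigenvalues and with \<open>sqrt\<close>
  for singular values.\<close>

lemma Min_image_le_Min_image:
  fixes f :: "'a \<Rightarrow> 'b::linorder"
  assumes "finite S" "finite T" "S \<noteq> {}" "\<And>k. k \<in> S \<Longrightarrow> \<exists>k'\<in>T. f k' \<le> f k"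
  shows "Min (f ` T) \<le> Min (f ` S)"
proof -
  have "Min (f ` S) \<in> f ` S" using assms by (intro Min_in) auto
  then obtain k where k: "k \<in> S" "Min (f ` S) = f k" by auto
  then obtain k' where "k' \<in> T" "f k' \<le> f k" using assms(4) by blast
  then have "Min (f ` T) \<le> f k" using assms(2) by (intro order.trans[OF Min_le]) auto
  then show ?thesis using k by simp
qed

subsection \<open>Norms and condition numbers\<close>

text \<open>The closed form of the norm induced by the maximum norm, and equally of the norm of the
  transpose induced by the 1-norm.\<close>

definition abs_row_sum :: "real mat \<Rightarrow> real" where
  "abs_row_sum B = Max ((\<lambda>i. \<Sum>j<dim_col B. \<bar>B $$ (i, j)\<bar>) ` {..<dim_row B})"

lemma abs_row_sum_ge:
  "B \<in> carrier_mat n m \<Longrightarrow> i < n \<Longrightarrow> (\<Sum>j<m. \<bar>B $$ (i, j)\<bar>) \<le> abs_row_sum B"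
  by (auto simp: abs_row_sum_def)

lemma abs_row_sum_attained:
  assumes "B \<in> carrier_mat n m" "n > 0"
  obtains i where "i < n" "abs_row_sum B = (\<Sum>j<m. \<bar>B $$ (i, j)\<bar>)"
proof -
  have "abs_row_sum B \<in> (\<lambda>i. \<Sum>j<dim_col B. \<bar>B $$ (i, j)\<bar>) ` {..<dim_row B}"
    unfolding abs_row_sum_def by (rule Max_in) (use assms in auto)
  then show ?thesis using that assms by auto
qed

text \<open>An upper bound attained at one nonzero vector makes the supremum a maximum, so
  boundedness of the set of quotients needs no separate argument.\<close>

lemma induced_norm_eqI:
  assumes B: "B \<in> carrier_mat n m"
    and pos: "\<And>x. x \<in> carrier_vec m \<Longrightarrow> x \<noteq> 0\<^sub>v m \<Longrightarrow> N x > 0"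
    and le: "\<And>x. x \<in> carrier_vec m \<Longrightarrow> N (B *\<^sub>v x) \<le> c * N x"
    and x: "x \<in> carrier_vec m" "x \<noteq> 0\<^sub>v m" "N (B *\<^sub>v x) \<ge> c * N x"
  shows "induced_norm N B = c"
  unfolding induced_norm_def
proof (rule cSup_eq_maximum)
  have "N (B *\<^sub>v x) / N x = c"
    using le[OF x(1)] x(3) pos[OF x(1,2)] by (simp add: field_simps)
  then show "c \<in> (\<lambda>x. N (B *\<^sub>v x) / N x) ` (carrier_vec (dim_col B) - {0\<^sub>v (dim_col B)})"
    using x B by force
next
  fix r assume "r \<in> (\<lambda>x. N (B *\<^sub>v x) / N x) ` (carrier_vec (dim_col B) - {0\<^sub>v (dim_col B)})"
  then obtain z where "z \<in> carrier_vec m" "z \<noteq> 0\<^sub>v m" "r = N (B *\<^sub>v z) / N z"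
    using B by auto
  with le[of z] pos[of z] show "r \<le> c" by (simp add: pos_divide_le_eq)
qed

lemma index_mult_mat_vec_sum:
  assumes "B \<in> carrier_mat n m" "x \<in> carrier_vec m" "i < n"
  shows "(B *\<^sub>v x) $ i = (\<Sum>j<m. B $$ (i, j) * x $ j)"
  using assms by (simp add: scalar_prod_def atLeast0LessThan)

lemma vec_norm_inf_ge: "x \<in> carrier_vec n \<Longrightarrow> i < n \<Longrightarrow> \<bar>x $ i\<bar> \<le> vec_norm_inf x"
  by (auto simp: vec_norm_inf_def)

lemma vec_norm_inf_le_iff:
  "x \<in> carrier_vec n \<Longrightarrow> n > 0 \<Longrightarrow> vec_norm_inf x \<le> c \<longleftrightarrow> (\<forall>i<n. \<bar>x $ i\<bar> \<le> c)"
  unfolding vec_norm_inf_def by (subst Max_le_iff) auto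

lemma induced_norm_inf:
  assumes B: "B \<in> carrier_mat n m" and n: "n > 0" "m > 0"
  shows "induced_norm vec_norm_inf B = abs_row_sum B"
proof -
  obtain i where i: "i < n" "abs_row_sum B = (\<Sum>j<m. \<bar>B $$ (i, j)\<bar>)"
    using abs_row_sum_attained[OF B n(1)] .
  \<comment> \<open>The sign pattern of a row with maximal absolute sum. Zero entries receive sign
    1, so that \<open>s\<close> is nonzero and has maximum norm 1.\<close>
  define s where "s = vec m (\<lambda>j. if B $$ (i, j) \<ge> 0 then 1 else (-1) :: real)"
  have s: "s \<in> carrier_vec m" by (simp add: s_def)
  show ?thesis
  proof (rule induced_norm_eqI[OF B _ _ s])
    fix x :: "real vec" assume x: "x \<in> carrier_vec m" "x \<noteq> 0\<^sub>v m"
    then obtain j where "j < m" "x $ j \<noteq> 0" by (rule nonzero_vec_entry)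
    then show "vec_norm_inf x > 0"
      using vec_norm_inf_ge[OF x(1), of j] by auto
  next
    fix x :: "real vec" assume x: "x \<in> carrier_vec m"
    have "\<bar>(B *\<^sub>v x) $ l\<bar> \<le> abs_row_sum B * vec_norm_inf x" if l: "l < n" for l
    proof -
      have "\<bar>(B *\<^sub>v x) $ l\<bar> \<le> (\<Sum>j<m. \<bar>B $$ (l, j)\<bar> * \<bar>x $ j\<bar>)"
        unfolding index_mult_mat_vec_sum[OF B x l] by (rule order.trans[OF sum_abs]) (simp add: abs_mult)
      also have "\<dots> \<le> (\<Sum>j<m. \<bar>B $$ (l, j)\<bar> * vec_norm_inf x)"
        using vec_norm_inf_ge[OF x] by (intro sum_mono mult_left_mono) auto
      also have "\<dots> \<le> abs_row_sum B * vec_norm_inf x"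
        unfolding sum_distrib_right[symmetric]
        using abs_row_sum_ge[OF B l] vec_norm_inf_ge[OF x n(2)]
        by (intro mult_right_mono) auto
      finally show ?thesis .
    qed
    moreover have "B *\<^sub>v x \<in> carrier_vec n" using B x by simp
    ultimately show "vec_norm_inf (B *\<^sub>v x) \<le> abs_row_sum B * vec_norm_inf x"
      using vec_norm_inf_le_iff n by blast
  next
    have "s $ 0 \<noteq> 0" using n by (simp add: s_def)
    then show "s \<noteq> 0\<^sub>v m" using n by auto
  next
    have "vec_norm_inf s \<le> 1"
      using n by (subst vec_norm_inf_le_iff[OF s]) (auto simp: s_def)
    moreover have "abs_row_sum B \<ge> 0" unfolding i by (rule sum_nonneg) simp
    ultimately have "abs_row_sum B * vec_norm_inf s \<le> abs_row_sum B"
      by (rule mult_left_le)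
    also have "\<dots> = (B *\<^sub>v s) $ i"
      unfolding i index_mult_mat_vec_sum[OF B s i(1)] by (intro sum.cong) (auto simp: s_def)
    also have "\<dots> \<le> vec_norm_inf (B *\<^sub>v s)"
      using vec_norm_inf_ge[of "B *\<^sub>v s" n i] B s i by simp
    finally show "vec_norm_inf (B *\<^sub>v s) \<ge> abs_row_sum B * vec_norm_inf s" .
  qed
qed

text \<open>Row \<open>i\<close> of \<open>B\<close> is column \<open>i\<close> of the transpose, so
  the unit vector at a maximal row attains the bound.\<close>

lemma induced_norm_1_transpose:
  assumes B: "B \<in> carrier_mat n m" and n: "n > 0"
  shows "induced_norm vec_norm_1 (transpose_mat B) = abs_row_sum B"
proof -
  obtain i where i: "i < n" "abs_row_sum B = (\<Sum>j<m. \<bar>B $$ (i, j)\<bar>)"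
    using abs_row_sum_attained[OF B n] .
  have BT: "transpose_mat B \<in> carrier_mat m n" using B by simp
  have u: "unit_vec n i \<in> carrier_vec n" by simp
  have ent: "(transpose_mat B *\<^sub>v x) $ j = (\<Sum>l<n. B $$ (l, j) * x $ l)"
    if "x \<in> carrier_vec n" "j < m" for x j
    using index_mult_mat_vec_sum[OF BT that] B that by simp
  have norm: "vec_norm_1 (transpose_mat B *\<^sub>v x) = (\<Sum>j<m. \<bar>\<Sum>l<n. B $$ (l, j) * x $ l\<bar>)"
    if "x \<in> carrier_vec n" for x
    using B that unfolding vec_norm_1_def by (intro sum.cong) (auto simp: ent simp del: index_mult_mat_vec)
  show ?thesis
  proof (rule induced_norm_eqI[OF BT _ _ u])
    fix x :: "real vec" assume x: "x \<in> carrier_vec n" "x \<noteq> 0\<^sub>v n"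
    then obtain j where "j < n" "x $ j \<noteq> 0" by (rule nonzero_vec_entry)
    then show "vec_norm_1 x > 0"
      using x(1) unfolding vec_norm_1_def by (intro sum_pos2[of _ j]) auto
  next
    fix x :: "real vec" assume x: "x \<in> carrier_vec n"
    have "vec_norm_1 (transpose_mat B *\<^sub>v x) \<le> (\<Sum>j<m. \<Sum>l<n. \<bar>B $$ (l, j)\<bar> * \<bar>x $ l\<bar>)"
      unfolding norm[OF x] by (intro sum_mono order.trans[OF sum_abs]) (simp add: abs_mult)
    also have "\<dots> = (\<Sum>l<n. (\<Sum>j<m. \<bar>B $$ (l, j)\<bar>) * \<bar>x $ l\<bar>)"
      by (subst sum.swap) (simp add: sum_distrib_right)
    also have "\<dots> \<le> (\<Sum>l<n. abs_row_sum B * \<bar>x $ l\<bar>)"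
      using abs_row_sum_ge[OF B] by (intro sum_mono mult_right_mono) auto
    also have "\<dots> = abs_row_sum B * vec_norm_1 x"
      using x by (simp add: vec_norm_1_def sum_distrib_left)
    finally show "vec_norm_1 (transpose_mat B *\<^sub>v x) \<le> abs_row_sum B * vec_norm_1 x" .
  next
    show "unit_vec n i \<noteq> (0\<^sub>v n :: real vec)" using i by simp
  next
    have "vec_norm_1 (unit_vec n i) = (1::real)"
      using i by (simp add: vec_norm_1_def unit_vec_def if_distrib[of abs] sum.delta cong: if_cong)
    moreover have "(\<Sum>l<n. B $$ (l, j) * unit_vec n i $ l) = B $$ (i, j)" for j
      using i by (simp add: unit_vec_def if_distrib[of "(*) _"] sum.delta cong: if_cong)
    ultimately show "vec_norm_1 (transpose_mat B *\<^sub>v unit_vec n i) \<ge> abs_row_sum B * vec_norm_1 (unit_vec n i)"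
      unfolding norm[OF u] by (simp add: i)
  qed
qed

section \<open>Invertibility and \<open>mat_inverse\<close>\<close>

lemma invertible_mat_det:
  fixes A :: "'a::field mat"
  assumes A: "A \<in> carrier_mat n n"
  shows "invertible_mat A \<longleftrightarrow> det A \<noteq> 0"
proof
  assume "invertible_mat A"
  then obtain B where B: "A * B = 1\<^sub>m n" "B * A = 1\<^sub>m (dim_row B)"
    using A by (auto simp: invertible_mat_def inverts_mat_def)
  then have "B \<in> carrier_mat n n"
    using A by (metis carrier_mat_triv carrier_matD index_mult_mat(2,3) index_one_mat(2,3))
  then show "det A \<noteq> 0" using det_nonzero_of_inverse[OF A _ B(1)] by simp
next
  assume "det A \<noteq> 0"
  then obtain B where "B \<in> carrier_mat n n" "B * A = 1\<^sub>m n" "A * B = 1\<^sub>m n"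
    \<comment> \<open>The parameter \<open>b\<close> fills the extension slot of the record
      \<open>ring_mat\<close>, so an arbitrary value serves.\<close>
    using det_non_zero_imp_unit[OF A, where b = undefined] by (auto simp: Units_def ring_mat_def)
  then show "invertible_mat A"
    using A by (auto simp: invertible_mat_def inverts_mat_def)
qed

lemma mat_inverse_invertible:
  fixes A :: "'a::field mat"
  assumes A: "A \<in> carrier_mat n n" and d: "det A \<noteq> 0"
  shows "the (mat_inverse A) \<in> carrier_mat n n" "A * the (mat_inverse A) = 1\<^sub>m n"
    "the (mat_inverse A) * A = 1\<^sub>m n"
proof -
  have "mat_inverse A \<noteq> None"
    using mat_inverse(1)[OF A, where b = undefined] det_non_zero_imp_unit[OF A d, where b = undefined] by auto
  then obtain B where "mat_inverse A = Some B" by auto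
  from this mat_inverse(2)[OF A this] show "the (mat_inverse A) \<in> carrier_mat n n"
    "A * the (mat_inverse A) = 1\<^sub>m n" "the (mat_inverse A) * A = 1\<^sub>m n"
    by auto
qed

lemma mat_inverse_unique:
  fixes A :: "'a::field mat"
  assumes A: "A \<in> carrier_mat n n" and B: "B \<in> carrier_mat n n" and AB: "A * B = 1\<^sub>m n"
  shows "the (mat_inverse A) = B"
proof -
  note inv = mat_inverse_invertible[OF A det_nonzero_of_inverse[OF A B AB]]
  have "the (mat_inverse A) = the (mat_inverse A) * (A * B)"
    using inv by (simp add: AB)
  also have "\<dots> = (the (mat_inverse A) * A) * B"
    by (rule assoc_mult_mat[symmetric, OF inv(1) A B])
  also have "\<dots> = B" using B by (simp add: inv)
  finally show ?thesis .
qed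

section \<open>Stochastic matrices and condition numbers\<close>

lemma stochastic_abs_row_sum:
  assumes K: "stochastic_mat K" "K \<in> carrier_mat n n" and i: "i < n"
  shows "(\<Sum>j<n. \<bar>K $$ (i, j)\<bar>) = 1"
proof -
  have "(\<Sum>j<n. \<bar>K $$ (i, j)\<bar>) = (\<Sum>j<n. K $$ (i, j))"
    using K i by (intro sum.cong) (auto simp: stochastic_mat_def)
  then show ?thesis using K i by (auto simp: stochastic_mat_def)
qed

lemma abs_row_sum_stochastic:
  assumes K: "stochastic_mat K" "K \<in> carrier_mat n n" and n: "n > 0"
  shows "abs_row_sum K = 1"
  using abs_row_sum_attained[OF K(2) n] stochastic_abs_row_sum[OF K] by metis

text \<open>Each row of \<open>K * B\<close> is a convex combination of rows of \<open>B\<close>, so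
  its absolute sum is at most an average of theirs.\<close>

lemma abs_row_sum_stochastic_mult_le:
  assumes K: "stochastic_mat K" "K \<in> carrier_mat n n" and B: "B \<in> carrier_mat n n" and n: "n > 0"
  shows "abs_row_sum (K * B) \<le> abs_row_sum B"
proof -
  have KB: "K * B \<in> carrier_mat n n" using K B by simp
  obtain i where i: "i < n" "abs_row_sum (K * B) = (\<Sum>j<n. \<bar>(K * B) $$ (i, j)\<bar>)"
    using abs_row_sum_attained[OF KB n] .
  have "(\<Sum>j<n. \<bar>(K * B) $$ (i, j)\<bar>) \<le> (\<Sum>j<n. \<Sum>l<n. \<bar>K $$ (i, l)\<bar> * \<bar>B $$ (l, j)\<bar>)"
  proof (rule sum_mono)
    fix j assume "j \<in> {..<n}"
    then show "\<bar>(K * B) $$ (i, j)\<bar> \<le> (\<Sum>l<n. \<bar>K $$ (i, l)\<bar> * \<bar>B $$ (l, j)\<bar>)"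
      by (simp add: index_mult_mat_sum[OF K(2) B i(1)] order.trans[OF sum_abs] abs_mult del: index_mult_mat)
  qed
  also have "\<dots> = (\<Sum>l<n. \<bar>K $$ (i, l)\<bar> * (\<Sum>j<n. \<bar>B $$ (l, j)\<bar>))"
    by (subst sum.swap) (simp add: sum_distrib_left)
  also have "\<dots> \<le> (\<Sum>l<n. \<bar>K $$ (i, l)\<bar> * abs_row_sum B)"
    using abs_row_sum_ge[OF B] by (intro sum_mono mult_left_mono) auto
  also have "\<dots> = abs_row_sum B"
    using stochastic_abs_row_sum[OF K i(1)] by (simp flip: sum_distrib_right)
  finally show ?thesis using i by simp
qed

lemma kappa_inf_eq:
  assumes B: "B \<in> carrier_mat n n" and n: "n > 0" and d: "det B \<noteq> 0"
  shows "kappa_inf B = abs_row_sum B * abs_row_sum (the (mat_inverse B))"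
  using induced_norm_inf[OF B n n] induced_norm_inf[OF mat_inverse_invertible(1)[OF B d] n n]
  by (simp add: cond_number_def)

lemma kappa_1_transpose_eq:
  assumes B: "B \<in> carrier_mat n n" and n: "n > 0" and d: "det B \<noteq> 0"
  shows "kappa_1 (transpose_mat B) = abs_row_sum B * abs_row_sum (the (mat_inverse B))"
proof -
  note B' = mat_inverse_invertible[OF B d]
  have "transpose_mat B * transpose_mat (the (mat_inverse B)) = 1\<^sub>m n"
    using transpose_mult[OF B'(1) B] B' by simp
  then have "the (mat_inverse (transpose_mat B)) = transpose_mat (the (mat_inverse B))"
    using B B' by (intro mat_inverse_unique[of _ n]) auto
  then show ?thesis
    using induced_norm_1_transpose[OF B n] induced_norm_1_transpose[OF B'(1) n]
    by (simp add: cond_number_def)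
qed

subsection \<open>Totally positive factors\<close>

text \<open>The inverse of \<open>A\<close> is \<open>K' M'\<close>, and with checkerboard signs
  every term of this product is nonnegative. Keeping only the term \<open>l = i\<close>, whose
  factor \<open>K' $$ (i, i)\<close> is at least 1, gives the bound.\<close>

lemma checkerboard_inverse_factor_le:
  fixes M K A :: "real mat"
  assumes car: "M \<in> carrier_mat n n" "K \<in> carrier_mat n n" and A: "A = M * K" and d: "det A \<noteq> 0"
    and tpM: "TP_fun n (\<lambda>i j. M $$ (i, j))" and tpK: "TP_fun n (\<lambda>i j. K $$ (i, j))"
    and K_le: "\<And>i. i < n \<Longrightarrow> K $$ (i, i) \<le> 1"
    and ij: "i < n" "j < n"
  shows "0 \<le> (-1) ^ (i + j) * the (mat_inverse M) $$ (i, j)"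
    and "(-1) ^ (i + j) * the (mat_inverse M) $$ (i, j) \<le> (-1) ^ (i + j) * the (mat_inverse A) $$ (i, j)"
proof -
  have dMK: "det M \<noteq> 0" "det K \<noteq> 0"
    using d det_mult[OF car] by (auto simp: A)
  define M' where "M' = the (mat_inverse M)"
  define K' where "K' = the (mat_inverse K)"
  note M' = mat_inverse_invertible[OF car(1) dMK(1), folded M'_def]
  note K' = mat_inverse_invertible[OF car(2) dMK(2), folded K'_def]
  have "A * (K' * M') = M * (K * (K' * M'))"
    unfolding A using car M' K' by (intro assoc_mult_mat) auto
  also have "K * (K' * M') = M'"
    using car M' K' by (simp flip: assoc_mult_mat[of _ n n _ n _ n])
  finally have "A * (K' * M') = 1\<^sub>m n"
    using M' by simp
  then have A': "the (mat_inverse A) = K' * M'"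
    using car M' K' by (intro mat_inverse_unique[of _ n]) (auto simp: A)
  have M'_nonneg: "0 \<le> (-1) ^ (l + j) * M' $$ (l, j)" if "l < n" for l
    by (rule TP_inverse_checkerboard_nonneg[OF car(1) M'(1,2) tpM that ij(2)])
  have K'_nonneg: "0 \<le> (-1) ^ (i + l) * K' $$ (i, l)" if "l < n" for l
    by (rule TP_inverse_checkerboard_nonneg[OF car(2) K'(1,2) tpK ij(1) that])
  have K'_diag: "K' $$ (i, i) \<ge> 1"
    by (rule TP_inverse_diag_ge_1[OF car(2) K'(1,2) tpK ij(1) K_le[OF ij(1)]])
  let ?f = "\<lambda>l. ((-1) ^ (i + l) * K' $$ (i, l)) * ((-1) ^ (l + j) * M' $$ (l, j))"
  have "(-1) ^ (i + j) * M' $$ (i, j) \<le> K' $$ (i, i) * ((-1) ^ (i + j) * M' $$ (i, j))"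
    using mult_right_mono[OF K'_diag M'_nonneg[OF ij(1)]] by simp
  also have "\<dots> = ?f i"
    by (simp flip: mult_2)
  also have "\<dots> \<le> (\<Sum>l<n. ?f l)"
    using ij mult_nonneg_nonneg[OF K'_nonneg M'_nonneg] by (intro member_le_sum) auto
  also have "\<dots> = (\<Sum>l<n. (-1) ^ (i + j) * (K' $$ (i, l) * M' $$ (l, j)))"
  proof (rule sum.cong)
    fix l
    have "?f l = ((-1) ^ (i + l) * (-1) ^ (l + j)) * (K' $$ (i, l) * M' $$ (l, j))"
      by (simp only: mult_ac)
    then show "?f l = (-1) ^ (i + j) * (K' $$ (i, l) * M' $$ (l, j))"
      by (simp only: minus_one_power_cancel)
  qed simp
  also have "\<dots> = (-1) ^ (i + j) * the (mat_inverse A) $$ (i, j)"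
    unfolding A' index_mult_mat_sum[OF K'(1) M'(1) ij] by (simp add: sum_distrib_left)
  finally show "(-1) ^ (i + j) * the (mat_inverse M) $$ (i, j) \<le> (-1) ^ (i + j) * the (mat_inverse A) $$ (i, j)"
    by (simp add: M'_def)
  show "0 \<le> (-1) ^ (i + j) * the (mat_inverse M) $$ (i, j)"
    using M'_nonneg[OF ij(1)] by (simp add: M'_def)
qed

lemma gram_inverse:
  fixes A B :: "'a::field mat"
  assumes A: "A \<in> carrier_mat n n" and B: "B \<in> carrier_mat n n"
    and AB: "A * B = 1\<^sub>m n" "B * A = 1\<^sub>m n"
  shows "(transpose_mat A * A) * (B * transpose_mat B) = 1\<^sub>m n"
    and "(B * transpose_mat B) * (transpose_mat A * A) = 1\<^sub>m n"
proof -
  have T: "transpose_mat A \<in> carrier_mat n n" "transpose_mat B \<in> carrier_mat n n"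
    using A B by auto
  have "(transpose_mat A * A) * (B * transpose_mat B) = transpose_mat A * (A * B) * transpose_mat B"
    using A B T by (simp add: assoc_mult_mat[of _ n n _ n _ n])
  also have "\<dots> = transpose_mat (B * A)"
    using A B T by (simp add: AB(1) transpose_mult)
  finally show "(transpose_mat A * A) * (B * transpose_mat B) = 1\<^sub>m n"
    by (simp add: AB(2))
  then show "(B * transpose_mat B) * (transpose_mat A * A) = 1\<^sub>m n"
    by (rule mat_mult_left_right_inverse[OF mult_carrier_mat[OF T(1) A] mult_carrier_mat[OF B T(2)]])
qed

text \<open>In matrix form \<open>J (B B^T) J = (J B J) (J B J)^T\<close>. This carries entrywise
  bounds for signed inverses over to the inverses of Gram matrices.\<close>

lemma gram_inverse_entry:
  fixes B :: "'a::comm_ring_1 mat"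
  assumes B: "B \<in> carrier_mat n n" and ij: "i < n" "j < n"
  shows "(-1) ^ (i + j) * (B * transpose_mat B) $$ (i, j) =
    (\<Sum>l<n. ((-1) ^ (i + l) * B $$ (i, l)) * ((-1) ^ (j + l) * B $$ (j, l)))"
proof -
  have "(B * transpose_mat B) $$ (i, j) = (\<Sum>l<n. B $$ (i, l) * B $$ (j, l))"
    using B ij by (subst index_mult_mat_sum[of _ n n _ n]) auto
  moreover have "((-1) ^ (i + l) * B $$ (i, l)) * ((-1) ^ (j + l) * B $$ (j, l)) =
      (-1) ^ (i + j) * (B $$ (i, l) * B $$ (j, l))" for l
  proof -
    have "((-1) ^ (i + l) * B $$ (i, l)) * ((-1) ^ (j + l) * B $$ (j, l)) =
        ((-1) ^ (i + l) * (-1) ^ (l + j)) * (B $$ (i, l) * B $$ (j, l))"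
      by (simp only: mult_ac add.commute)
    then show ?thesis by (simp only: minus_one_power_cancel)
  qed
  ultimately show ?thesis by (simp add: sum_distrib_left)
qed

text \<open>As \<open>K\<close> is nonsingular, \<open>A\<close> and \<open>M\<close> are singular
  together. In the singular case 0 is an eigenvalue on the side of \<open>A\<close> and a lower
  bound on the side of \<open>M\<close>; otherwise the ordered signed inverses allow
  \<open>eigenvalue_le_of_inverse_le\<close>.\<close>

lemma TP_factor_eigenvalue_le:
  fixes M K A :: "real mat"
  assumes car: "M \<in> carrier_mat n n" "K \<in> carrier_mat n n" and A: "A = M * K" and dK: "det K \<noteq> 0"
    and tpM: "TP_fun n (\<lambda>i j. M $$ (i, j))" and tpK: "TP_fun n (\<lambda>i j. K $$ (i, j))"
    and K_le: "\<And>i. i < n \<Longrightarrow> K $$ (i, i) \<le> 1"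
  shows "eigenvalue M k \<Longrightarrow> \<exists>k'\<le>k. eigenvalue A k'"
    and "eigenvalue (transpose_mat M * M) k \<Longrightarrow> \<exists>k'\<le>k. eigenvalue (transpose_mat A * A) k'"
proof -
  have carA: "A \<in> carrier_mat n n" using car by (simp add: A)
  have G: "transpose_mat X * X \<in> carrier_mat n n" if "X \<in> carrier_mat n n" for X :: "real mat"
    using that by simp
  have detG: "det (transpose_mat X * X) = det X * det X" if "X \<in> carrier_mat n n" for X :: "real mat"
    using that by (subst det_mult[of _ n]) (auto simp: det_transpose)
  have dA: "det A = 0 \<longleftrightarrow> det M = 0"
    using dK det_mult[OF car] by (simp add: A)
  define M' where "M' = the (mat_inverse M)"
  define A' where "A' = the (mat_inverse A)"
  note M' = mat_inverse_invertible[OF car(1), folded M'_def]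
  note A' = mat_inverse_invertible[OF carA, folded A'_def]
  have le: "0 \<le> (-1) ^ (i + j) * M' $$ (i, j)"
    "(-1) ^ (i + j) * M' $$ (i, j) \<le> (-1) ^ (i + j) * A' $$ (i, j)"
    if "det A \<noteq> 0" "i < n" "j < n" for i j
    unfolding M'_def A'_def using checkerboard_inverse_factor_le[OF car A that(1) tpM tpK K_le that(2,3)]
    by auto
  show "\<exists>k'\<le>k. eigenvalue A k'" if k: "eigenvalue M k"
  proof (cases "det A = 0")
    case True
    then have "eigenvalue A 0" using eigenvalue_0_iff[OF carA] by simp
    then show ?thesis using TP_mat_eigenvalue_nonneg[OF car(1) tpM k] by blast
  next
    case False
    then have "k \<noteq> 0" using eigenvalue_0_iff[OF car(1)] dA k by auto
    then have "k > 0" using TP_mat_eigenvalue_nonneg[OF car(1) tpM k] by simp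
    then show ?thesis
      using False dA le A' M' car carA k by (intro eigenvalue_le_of_inverse_le[of A n A' M M']) auto
  qed
  show "\<exists>k'\<le>k. eigenvalue (transpose_mat A * A) k'" if k: "eigenvalue (transpose_mat M * M) k"
  proof (cases "det A = 0")
    case True
    then have "eigenvalue (transpose_mat A * A) 0"
      using eigenvalue_0_iff[OF G[OF carA]] detG[OF carA] by simp
    then show ?thesis using gram_eigenvalue_nonneg[OF car(1) k] by blast
  next
    case False
    then have dM: "det M \<noteq> 0" using dA by simp
    then have "k \<noteq> 0" using eigenvalue_0_iff[OF G[OF car(1)]] detG[OF car(1)] k by auto
    then have kpos: "k > 0" using gram_eigenvalue_nonneg[OF car(1) k] by simp
    note M' = M'[OF dM] and A' = A'[OF False] and le = le[OF False]
    have A'_nonneg: "0 \<le> (-1) ^ (i + j) * A' $$ (i, j)" if "i < n" "j < n" for i j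
      using le[OF that] by (rule order.trans)
    have nonneg: "0 \<le> (-1) ^ (i + j) * (M' * transpose_mat M') $$ (i, j)" if ij: "i < n" "j < n" for i j
      unfolding gram_inverse_entry[OF M'(1) ij]
      by (intro sum_nonneg mult_nonneg_nonneg le(1)) (use ij in simp_all)
    \<comment> \<open>Both factors of each summand are nonnegative and grow from \<open>M'\<close>
      to \<open>A'\<close>, hence so do their products.\<close>
    have mono: "(-1) ^ (i + j) * (M' * transpose_mat M') $$ (i, j)
        \<le> (-1) ^ (i + j) * (A' * transpose_mat A') $$ (i, j)" if ij: "i < n" "j < n" for i j
      unfolding gram_inverse_entry[OF M'(1) ij] gram_inverse_entry[OF A'(1) ij]
      by (intro sum_mono mult_mono le A'_nonneg) (use ij in simp_all)
    show ?thesis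
      by (rule eigenvalue_le_of_inverse_le[OF G[OF carA] _ G[OF car(1)] _ 
            gram_inverse(1)[OF carA A'] gram_inverse(2)[OF car(1) M'] nonneg mono k kpos])
        (use M' A' in auto)
  qed
qed

section \<open>Collocation matrices of NTP bases and the comparison\<close>

lemma collocation_mat_NTP:
  assumes "NTP_basis I U n u" "nodes_in I n t"
  shows "stochastic_mat (collocation_mat n n u t)"
    and "TP_fun (n + 1) (\<lambda>i j. collocation_mat n n u t $$ (i, j))"
proof -
  have C: "collocation_mat n n u t \<in> carrier_mat (n + 1) (n + 1)"
    by (simp add: collocation_mat_def)
  have "totally_positive_mat (collocation_mat n n u t)"
    using assms by (auto simp: NTP_basis_def TP_system_def)
  with C show tp: "TP_fun (n + 1) (\<lambda>i j. collocation_mat n n u t $$ (i, j))"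
    by (rule totally_positive_mat_imp_TP_fun)
  have "(\<Sum>j<n + 1. u j (t i)) = 1" if "i < n + 1" for i
    using assms that by (auto simp: NTP_basis_def normalized_system_def nodes_in_def lessThan_Suc_atMost)
  then show "stochastic_mat (collocation_mat n n u t)"
    using TP_fun_nonneg[OF tp] C by (auto simp: stochastic_mat_def collocation_mat_def)
qed

theorem corollary3p3:
  fixes a b :: real
    and U :: "(real \<Rightarrow> real) set"
    and n :: nat
    and u v :: "nat \<Rightarrow> real \<Rightarrow> real"
    and t :: "nat \<Rightarrow> real"
    and A M :: "real mat"
  assumes "function_space {a..b} U"
    and "NTP_basis {a..b} U n u"
    and "normalized_B_basis {a..b} U n v"
    and "nodes_in {a..b} n t"
    and "A = collocation_mat n n u t"
    and "M = collocation_mat n n v t"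
  shows "min_eigenvalue M \<ge> min_eigenvalue A \<and>
         min_singular_value M \<ge> min_singular_value A \<and>
         (invertible_mat A \<and> invertible_mat M \<longrightarrow>
            kappa_1 (transpose_mat M) = kappa_inf M \<and>
            kappa_inf M \<le> kappa_inf A \<and>
            kappa_inf A = kappa_1 (transpose_mat A))"
proof -
  let ?N = "n + 1"
  have v: "NTP_basis {a..b} U n v"
    using assms(3) by (simp add: normalized_B_basis_def)
  \<comment> \<open>The optimality of the normalized B-basis, applied to \<open>u\<close>, is the
    source of the factor \<open>K\<close>; evaluating the change of basis at the nodes then yields
    \<open>A = M * K\<close>.\<close>
  obtain K where K: "K \<in> carrier_mat ?N ?N" "invertible_mat K" "stochastic_mat K" "totally_positive_mat K"
    and uK: "\<And>j x. j \<le> n \<Longrightarrow> x \<in> {a..b} \<Longrightarrow> u j x = (\<Sum>i\<le>n. v i x * K $$ (i, j))"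
    using assms(2,3) unfolding normalized_B_basis_def by blast
  have A: "A \<in> carrier_mat ?N ?N" and M: "M \<in> carrier_mat ?N ?N"
    by (auto simp: assms(5,6) collocation_mat_def)
  have stA: "stochastic_mat A" and stM: "stochastic_mat M" and tpM: "TP_fun ?N (\<lambda>i j. M $$ (i, j))"
    using collocation_mat_NTP[OF assms(2,4)] collocation_mat_NTP[OF v assms(4)] by (auto simp: assms(5,6))
  have tpK: "TP_fun ?N (\<lambda>i j. K $$ (i, j))"
    by (rule totally_positive_mat_imp_TP_fun[OF K(1,4)])
  have dK: "det K \<noteq> 0" using invertible_mat_det[OF K(1)] K(2) by simp
  have AMK: "A = M * K"
  proof (rule eq_matI)
    fix i j assume "i < dim_row (M * K)" "j < dim_col (M * K)"
    then have ij: "i < ?N" "j < ?N" using M K(1) by auto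
    have "t i \<in> {a..b}" using assms(4) ij by (auto simp: nodes_in_def)
    then have "A $$ (i, j) = (\<Sum>l\<le>n. v l (t i) * K $$ (l, j))"
      using uK[of j "t i"] ij by (simp add: assms(5) collocation_mat_def)
    also have "\<dots> = (\<Sum>l<?N. M $$ (i, l) * K $$ (l, j))"
      using ij by (auto simp: assms(6) collocation_mat_def lessThan_Suc_atMost intro!: sum.cong)
    also have "\<dots> = (M * K) $$ (i, j)"
      by (rule index_mult_mat_sum[OF M K(1) ij, symmetric])
    finally show "A $$ (i, j) = (M * K) $$ (i, j)" .
  qed (use A M K(1) in auto)
  \<comment> \<open>A single entry of a stochastic row is at most the row sum 1.\<close>
  have K_le: "K $$ (i, i) \<le> 1" if i: "i < ?N" for i
  proof -
    have "K $$ (i, i) \<le> (\<Sum>j<?N. \<bar>K $$ (i, j)\<bar>)"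
      using i by (intro order.trans[OF abs_ge_self member_le_sum[of i _ "\<lambda>j. \<bar>K $$ (i, j)\<bar>"]]) auto
    then show ?thesis using stochastic_abs_row_sum[OF K(3,1) i] by simp
  qed
  note le = TP_factor_eigenvalue_le[OF M K(1) AMK dK tpM tpK K_le]
  have GM: "transpose_mat M * M \<in> carrier_mat ?N ?N" and GA: "transpose_mat A * A \<in> carrier_mat ?N ?N"
    using M A by auto
  have M_nonneg: "M $$ (i, j) \<ge> 0" if "i < ?N" "j < ?N" for i j
    using stM M that by (auto simp: stochastic_mat_def)
  have "min_eigenvalue A \<le> min_eigenvalue M"
    using Min_image_le_Min_image[of "{k. eigenvalue M k}" "{k. eigenvalue A k}" "\<lambda>k. k"]
      finite_eigenvalues[OF M] finite_eigenvalues[OF A] nonneg_mat_eigenvalue_ex[OF M _ M_nonneg] le(1)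
    by (auto simp: min_eigenvalue_def)
  moreover have "min_singular_value A \<le> min_singular_value M"
    unfolding min_singular_value_def singular_values_def
  proof (rule Min_image_le_Min_image)
    \<comment> \<open>The Gram matrix of the nonnegative \<open>M\<close> is nonnegative, hence has
      a real eigenvalue.\<close>
    have "(transpose_mat M * M) $$ (i, j) \<ge> 0" if "i < ?N" "j < ?N" for i j
      using M M_nonneg that by (subst index_mult_mat_sum[of _ ?N ?N _ ?N]) (auto intro!: sum_nonneg simp del: sum.lessThan_Suc)
    then show "{k. eigenvalue (transpose_mat M * M) k} \<noteq> {}"
      by (intro nonneg_mat_eigenvalue_ex[OF GM]) auto
  qed (use finite_eigenvalues[OF GM] finite_eigenvalues[OF GA] le(2) in auto)
  moreover have "kappa_1 (transpose_mat M) = kappa_inf M \<and> kappa_inf M \<le> kappa_inf A \<and>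
      kappa_inf A = kappa_1 (transpose_mat A)" if inv: "invertible_mat A" "invertible_mat M"
  proof -
    have N: "?N > 0" by simp
    have dA: "det A \<noteq> 0" and dM: "det M \<noteq> 0"
      using inv invertible_mat_det[OF A] invertible_mat_det[OF M] by auto
    note A' = mat_inverse_invertible[OF A dA]
    \<comment> \<open>From \<open>A = M * K\<close>, the inverse of \<open>M\<close> is
      \<open>K\<close> times the inverse of \<open>A\<close>, and multiplying by the stochastic
      \<open>K\<close> does not increase the norm.\<close>
    have "M * (K * the (mat_inverse A)) = A * the (mat_inverse A)"
      unfolding AMK using M K(1) A'(1) by (intro assoc_mult_mat[symmetric]) (auto simp: AMK)
    then have "the (mat_inverse M) = K * the (mat_inverse A)"
      using M K(1) A' by (intro mat_inverse_unique[of _ ?N]) auto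
    then have "abs_row_sum (the (mat_inverse M)) \<le> abs_row_sum (the (mat_inverse A))"
      using abs_row_sum_stochastic_mult_le[OF K(3,1) A'(1) N] by simp
    \<comment> \<open>Both \<open>A\<close> and \<open>M\<close> are stochastic and have norm 1, so
      each condition number reduces to the norm of the inverse.\<close>
    then show ?thesis
      using kappa_inf_eq[OF A N dA] kappa_inf_eq[OF M N dM]
        kappa_1_transpose_eq[OF A N dA] kappa_1_transpose_eq[OF M N dM]
        abs_row_sum_stochastic[OF stA A N] abs_row_sum_stochastic[OF stM M N] by simp
  qed
  ultimately show ?thesis by blast
qed

end
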